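(* For any $z_0,z_1\in\ell'$ and any $k\in\mathbb{Z}\setminus\{0\}$ there exists $u\in\mathcal H^k_{z_0z_1}$ such that $\mathcal M(u)=\min_{v\in\mathcal H^k_{z_0z_1}}\mathcal M(v)$.
   Context: Fix $L,h,\beta>0$, $V_\beta(z)=-\frac1{|z|}-\frac{\beta}{|z|^2}$, $\ell=\{y=-L\}$, $\mathcal P=\{y>-L\}$. Winding number: for $u:[a,b]\to\overline{\mathcal P}$ with $u(a),u(b)\in\ell$, $u(s)\in\mathcal P\setminus\{0\}$ on $(a,b)$, $\operatorname{Ind}(u)$ is the winding number around $0$ of the closed curve formed by $u$ followed by the oriented segment from $u(b)$ to $u(a)$. Fix a solution $\hat{\mathcal Z}$ of $\ddot z=-\nabla V_\beta(z)$ at energy $h$ which meets $\ell$ at times $t_0<t_1$ at $(\hat x_0,-L)$, $(\hat x_1,-L)$, lies in $\mathcal P$ on $(t_0,t_1)$, has winding number $1$ on $[t_0,t_1]$, with the angle between $\dot{\hat{\mathcal Z}}(t_0)$ and $(1,0)$ less than $\pi/2$ and the angle between $(-1,0)$ and $\dot{\hat{\mathcal Z}}(t_1)$ greater than $\pi/2$. Let $\ell'$ be the segment of $\ell$ between these two points and $D$ the compact region bounded by the arc $\hat{\mathcal Z}([t_0,t_1])$ and $\ell'$. For $z_0,z_1\in\ell'$, $k\ne0$: $\hat{\mathcal H}^k_{z_0z_1}=\{u\in H^1([0,1],D):u(0)=z_0,u(1)=z_1,u(s)\neq0\ \forall s,\operatorname{Ind}(u)=k\}$, $Coll_{z_0z_1}$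 the set of $u\in H^1([0,1],D)$ with the same endpoints vanishing somewhere, $\mathcal H^k_{z_0z_1}=\hat{\mathcal H}^k_{z_0z_1}\sqcup Coll_{z_0z_1}$. $\mathcal M(u)=\frac12\int_0^1|\dot u|^2ds\int_0^1(h-V_\beta(u))ds$. *)

theory Defs
  imports "HOL-Analysis.Analysis" "HOL-Complex_Analysis.Complex_Analysis"
begin

definition V :: "real \<Rightarrow> complex \<Rightarrow> real" where
  "V \<beta> z = - 1 / cmod z - \<beta> / (cmod z)^2"

definition vec_angle :: "complex \<Rightarrow> complex \<Rightarrow> real" where
  "vec_angle u v = arccos (inner u v / (cmod u * cmod v))"

definition ind_on :: "(real \<Rightarrow> complex) \<Rightarrow> real \<Rightarrow> real \<Rightarrow> complex" where
  "ind_on u a b = winding_number ((u \<circ> (\<lambda>s. a + s * (b - a))) +++ linepath (u b) (u a)) 0"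

definition region_D :: "(real \<Rightarrow> complex) \<Rightarrow> real \<Rightarrow> real \<Rightarrow> complex set" where
  "region_D Z t0 t1 =
     (let \<gamma> = (Z \<circ> (\<lambda>s. t0 + s * (t1 - t0))) +++ linepath (Z t1) (Z t0)
      in path_image \<gamma> \<union> inside (path_image \<gamma>))"

definition H1_deriv :: "(real \<Rightarrow> complex) \<Rightarrow> (real \<Rightarrow> complex) \<Rightarrow> bool" where
  "H1_deriv u u' \<longleftrightarrow>
     set_integrable lborel {0..1} u' \<and>
     (\<integral>\<^sup>+ s\<in>{0..1}. ennreal ((cmod (u' s))^2) \<partial>lborel) < \<infinity> \<and>
     (\<forall>t\<in>{0..1}. u t = u 0 + (LINT s:{0..t}|lborel. u' s))"

definition H1 :: "(real \<Rightarrow> complex) \<Rightarrow> bool" where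
  "H1 u \<longleftrightarrow> (\<exists>u'. H1_deriv u u')"

definition kinetic :: "(real \<Rightarrow> complex) \<Rightarrow> ennreal" where
  "kinetic u = (\<integral>\<^sup>+ s\<in>{0..1}. ennreal ((cmod ((SOME u'. H1_deriv u u') s))^2) \<partial>lborel)"

definition potential :: "real \<Rightarrow> real \<Rightarrow> (real \<Rightarrow> complex) \<Rightarrow> ennreal" where
  "potential \<beta> h u = (\<integral>\<^sup>+ s\<in>{0..1}.
      (if u s = 0 then \<infinity> else ennreal (h - V \<beta> (u s))) \<partial>lborel)"

definition Maupertuis :: "real \<Rightarrow> real \<Rightarrow> (real \<Rightarrow> complex) \<Rightarrow> ennreal" where
  "Maupertuis \<beta> h u = ennreal (1/2) * kinetic u * potential \<beta> h u"

definition Hhat :: "complex set \<Rightarrow> complex \<Rightarrow> complex \<Rightarrow> int \<Rightarrow> (real \<Rightarrow> complex) set" where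
  "Hhat D z0 z1 k = {u. H1 u \<and> u ` {0..1} \<subseteq> D \<and> u 0 = z0 \<and> u 1 = z1 \<and>
      (\<forall>s\<in>{0..1}. u s \<noteq> 0) \<and> ind_on u 0 1 = of_int k}"

definition Coll :: "complex set \<Rightarrow> complex \<Rightarrow> complex \<Rightarrow> (real \<Rightarrow> complex) set" where
  "Coll D z0 z1 = {u. H1 u \<and> u ` {0..1} \<subseteq> D \<and> u 0 = z0 \<and> u 1 = z1 \<and>
      (\<exists>s\<in>{0..1}. u s = 0)}"

definition Hk :: "complex set \<Rightarrow> complex \<Rightarrow> complex \<Rightarrow> int \<Rightarrow> (real \<Rightarrow> complex) set" where
  "Hk D z0 z1 k = Hhat D z0 z1 k \<union> Coll D z0 z1"

end

theory Submission
  imports Defs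
begin

text \<open>
  Direct method. Along a minimizing sequence the potential factor is at least \<open>h\<close>, so the kinetic
  factor is bounded; the curves are then uniformly \<open>1/2\<close>-Hoelder and have values in a compact set,
  and Arzela--Ascoli gives a uniform limit. The limit lies in the class, because a limit that avoids the
  origin inherits the winding number of the curves near it and every other limit is a collision.

  Weak compactness in \<open>H\<^sup>1\<close> is avoided by testing membership on dyadic partitions: a continuous \<open>u\<close> is in
  \<open>H\<^sup>1\<close> with \<open>\<integral>|u'|\<^sup>2 \<le> K\<close> iff all its dyadic energies are at most \<open>K\<close>, and each of
  them depends on finitely many values of \<open>u\<close>, so lower semicontinuity is immediate. The potential factor is
  lower semicontinuous by Fatou. The class is not empty since the boundary arc is Lipschitz and encloses the origin,
  so that Lipschitz curves in \<open>D\<close> join both endpoints to the origin.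
\<close>

section \<open>Sobolev curves and their weak derivatives\<close>

text \<open>The Borel sets over which \<open>f\<close> integrates to zero contain the intervals and
  are closed under complements, by \<open>tot\<close>, and under countable disjoint unions. They are
  therefore all Borel sets, and a function with zero integral over every one of them vanishes almost
  everywhere.\<close>

lemma borel_integral_zero_imp_AE:
  fixes f :: "real \<Rightarrow> 'a :: {banach, second_countable_topology}"
  assumes f: "integrable lborel f"
    and Ioc: "\<And>a b. a \<le> b \<Longrightarrow> (LINT s:{a<..b}|lborel. f s) = 0"
    and tot: "(LINT s|lborel. f s) = 0"
  shows "AE s in lborel. f s = 0"
proof (rule sigma_finite_measure.density_zero[OF sigma_finite_lborel f])
  have si: "set_integrable lborel B f" if "B \<in> sets borel" for B
    using that f unfolding set_integrable_def by (intro integrable_mult_indicator) auto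
  fix A :: "real set" assume "A \<in> sets lborel"
  then have "A \<in> sets borel" by simp
  then show "set_lebesgue_integral lborel A f = 0"
  proof (induction rule: borel_set_induct)
    case empty show ?case by (simp add: set_lebesgue_integral_def)
  next
    case (interval a b)
    \<comment> \<open>The induction offers closed intervals and the hypothesis speaks of half-open
      ones; the two differ by the null set \<open>{a}\<close>.\<close>
    have "AE s in lborel. s \<noteq> a" by (rule AE_lborel_singleton)
    then have "AE s in lborel. indicator {a..b} s *\<^sub>R f s = indicator {a<..b} s *\<^sub>R f s"
      by eventually_elim (auto split: split_indicator)
    then have "set_lebesgue_integral lborel {a..b} f = set_lebesgue_integral lborel {a<..b} f"
      unfolding set_lebesgue_integral_def using f by (intro integral_cong_AE) auto
    then show ?case using Ioc[OF interval] by simp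
  next
    case (compl A)
    have "set_lebesgue_integral lborel (A \<union> -A) f = set_lebesgue_integral lborel A f + set_lebesgue_integral lborel (-A) f"
      using compl by (intro set_integral_Un si) auto
    moreover have "set_lebesgue_integral lborel (A \<union> -A) f = 0"
      using tot by (simp add: set_lebesgue_integral_def)
    ultimately show ?case using compl by simp
  next
    case (union B)
    have "set_lebesgue_integral lborel (\<Union>i. B i) f = (\<Sum>i. set_lebesgue_integral lborel (B i) f)"
      using union by (intro lebesgue_integral_countable_add si) (auto simp: disjoint_family_on_def)
    then show ?case using union by simp
  qed
qed

lemma H1_derivD:
  assumes "H1_deriv u w"
  shows "set_integrable lborel {0..1} w"
    and "(\<integral>\<^sup>+ s\<in>{0..1}. ennreal ((cmod (w s))\<^sup>2) \<partial>lborel) < \<infinity>"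
    and "t \<in> {0..1} \<Longrightarrow> u t = u 0 + (LINT s:{0..t}|lborel. w s)"
  using assms unfolding H1_deriv_def by blast+

text \<open>Half-open intervals make the splitting of \<open>{0..t}\<close> at \<open>s\<close>
  disjoint.\<close>

lemma H1_deriv_increment:
  assumes "H1_deriv u w" "0 \<le> s" "s \<le> t" "t \<le> 1"
  shows "u t - u s = (LINT r:{s<..t}|lborel. w r)"
proof -
  have i: "set_integrable lborel {0..1} w" by (rule H1_derivD[OF assms(1)])
  have "(LINT r:{0..s} \<union> {s<..t}|lborel. w r) = (LINT r:{0..s}|lborel. w r) + (LINT r:{s<..t}|lborel. w r)"
    using assms by (intro set_integral_Un set_integrable_subset[OF i]) auto
  moreover have "{0..s} \<union> {s<..t} = {0..t}" using assms by auto
  moreover note H1_derivD(3)[OF assms(1), of s] H1_derivD(3)[OF assms(1), of t]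
  ultimately show ?thesis using assms(2-) by (metis add_diff_cancel_left add_diff_cancel_left' atLeastAtMost_iff
    diff_add_eq_diff_diff_swap diff_diff_eq order_trans)
qed

text \<open>This makes \<open>kinetic\<close> meaningful: its definition selects a derivative by
  \<open>SOME\<close>, and two candidates can differ only on a null set because all their interval
  integrals are increments of the same \<open>u\<close>.\<close>

lemma H1_deriv_unique:
  assumes "H1_deriv u w" "H1_deriv u w'"
  shows "AE s in lborel. s \<in> {0..1} \<longrightarrow> w s = w' s"
proof -
  have i: "set_integrable lborel {0..1} w" "set_integrable lborel {0..1} w'"
    by (rule assms[THEN H1_derivD(1)])+
  define f where "f = (\<lambda>s. indicator {0..1::real} s *\<^sub>R (w s - w' s))"
  have fi: "integrable lborel f"
    using set_integral_diff(1)[OF i] by (simp add: set_integrable_def f_def)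
  have zero: "(LINT s:{a<..b}|lborel. w s - w' s) = 0" if "0 \<le> a" "a \<le> b" "b \<le> 1" for a b
  proof -
    have "set_integrable lborel {a<..b} w" "set_integrable lborel {a<..b} w'"
      using that by (auto intro: i[THEN set_integrable_subset])
    then show ?thesis
      using H1_deriv_increment[OF assms(1) that] H1_deriv_increment[OF assms(2) that] by simp
  qed
  have zero': "(LINT s:{a<..b}|lborel. f s) = 0" if "a \<le> b" for a b
  proof (cases "max 0 a \<le> min 1 b")
    case True
    \<comment> \<open>Clipping the interval to the unit interval loses the point 0 when
      \<open>a < 0\<close>, which is a null set.\<close>
    have "AE s in lborel. s \<noteq> 0" by (rule AE_lborel_singleton)
    then have "AE s in lborel. indicator {a<..b} s *\<^sub>R f s = indicator {max 0 a<..min 1 b} s *\<^sub>R (w s - w' s)"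
      by eventually_elim (auto split: split_indicator simp: f_def)
    moreover have "set_integrable lborel {max 0 a<..min 1 b} (\<lambda>s. w s - w' s)"
      by (rule set_integrable_subset[OF set_integral_diff(1)[OF i]]) auto
    ultimately have "(LINT s:{a<..b}|lborel. f s) = (LINT s:{max 0 a<..min 1 b}|lborel. w s - w' s)"
      unfolding set_lebesgue_integral_def set_integrable_def using fi
      by (intro integral_cong_AE) (auto dest: borel_measurable_integrable)
    then show ?thesis using zero True by simp
  next
    case False
    then have "\<And>s. indicator {a<..b} s *\<^sub>R f s = 0" using that
      by (auto split: split_indicator simp: f_def min_def max_def split: if_splits)
    then show ?thesis unfolding set_lebesgue_integral_def by (simp only: integral_zero)
  qed
  have tot: "(LINT s|lborel. f s) = 0"
  proof -
    \<comment> \<open>Since \<open>f\<close> vanishes off \<open>{0..1}\<close>, its total integral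
      is one over a half-open interval; the left end is negative so that 0 is included.\<close>
    have *: "\<And>s. f s = indicator {-1<..1} s *\<^sub>R f s" by (auto split: split_indicator simp: f_def)
    have "(LINT s|lborel. f s) = (LINT s:{-1<..1}|lborel. f s)"
      unfolding set_lebesgue_integral_def by (rule Bochner_Integration.integral_cong[OF refl *])
    then show ?thesis using zero' by simp
  qed
  have "AE s in lborel. f s = 0"
    by (rule borel_integral_zero_imp_AE[OF fi zero' tot])
  then show ?thesis by eventually_elim (auto simp: f_def)
qed

lemma kinetic_eq:
  assumes "H1_deriv u w"
  shows "kinetic u = (\<integral>\<^sup>+ s\<in>{0..1}. ennreal ((cmod (w s))\<^sup>2) \<partial>lborel)"
proof -
  have "H1_deriv u (SOME u'. H1_deriv u u')" by (rule someI[where P = "H1_deriv u"]) fact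
  from H1_deriv_unique[OF this assms] show ?thesis
    unfolding kinetic_def
    by (intro nn_integral_cong_AE, eventually_elim) (auto split: split_indicator)
qed

section \<open>Cauchy-Schwarz and the Hoelder estimate\<close>

text \<open>Cauchy-Schwarz against the indicator of the interval, whose square integrates to
  \<open>t - s\<close>. In extended nonnegative reals, square integrability need not be known
  beforehand.\<close>

lemma norm_set_integral_square_le:
  fixes f :: "real \<Rightarrow> complex"
  assumes f: "set_integrable lborel {s<..t} f" and st: "s \<le> t"
  shows "ennreal ((cmod (LINT r:{s<..t}|lborel. f r))\<^sup>2)
    \<le> ennreal (t - s) * (\<integral>\<^sup>+ r\<in>{s<..t}. ennreal ((cmod (f r))\<^sup>2) \<partial>lborel)"
proof -
  let ?I = "indicator {s<..t} :: real \<Rightarrow> ennreal"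
  let ?g = "\<lambda>r. indicator {s<..t} r *\<^sub>R f r"
  have g: "integrable lborel ?g" using f by (simp add: set_integrable_def)
  have [measurable]: "?g \<in> borel_measurable borel" using borel_measurable_integrable[OF g] by simp
  have "ennreal (cmod (LINT r:{s<..t}|lborel. f r)) \<le> (\<integral>\<^sup>+ r. ennreal (cmod (?g r)) \<partial>lborel)"
    unfolding set_lebesgue_integral_def by (rule integral_norm_bound_ennreal[OF g])
  also have "\<dots> = (\<integral>\<^sup>+ r. ennreal (cmod (?g r)) * ?I r \<partial>lborel)"
    by (intro nn_integral_cong) (auto split: split_indicator)
  finally have "(ennreal (cmod (LINT r:{s<..t}|lborel. f r)))\<^sup>2 \<le> (\<integral>\<^sup>+ r. ennreal (cmod (?g r)) * ?I r \<partial>lborel)\<^sup>2"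
    by (intro power_mono) auto
  also have "\<dots> \<le> (\<integral>\<^sup>+ r. (ennreal (cmod (?g r)))\<^sup>2 \<partial>lborel) * (\<integral>\<^sup>+ r. (?I r)\<^sup>2 \<partial>lborel)"
    by (intro Cauchy_Schwarz_nn_integral) measurable
  also have "(\<integral>\<^sup>+ r. (?I r)\<^sup>2 \<partial>lborel) = (\<integral>\<^sup>+ r. ?I r \<partial>lborel)"
    by (intro nn_integral_cong) (auto split: split_indicator)
  also have "\<dots> = ennreal (t - s)" using st by simp
  also have "(\<integral>\<^sup>+ r. (ennreal (cmod (?g r)))\<^sup>2 \<partial>lborel) = (\<integral>\<^sup>+ r\<in>{s<..t}. ennreal ((cmod (f r))\<^sup>2) \<partial>lborel)"
    by (intro nn_integral_cong) (auto split: split_indicator simp: ennreal_power)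
  finally show ?thesis by (simp add: ennreal_power mult.commute)
qed

lemma H1_deriv_norm_increment:
  assumes "H1_deriv u w" "0 \<le> s" "s \<le> t" "t \<le> 1"
  shows "ennreal ((cmod (u t - u s))\<^sup>2)
    \<le> ennreal (t - s) * (\<integral>\<^sup>+ r\<in>{s<..t}. ennreal ((cmod (w r))\<^sup>2) \<partial>lborel)"
  unfolding H1_deriv_increment[OF assms]
proof (rule norm_set_integral_square_le)
  show "set_integrable lborel {s<..t} w"
    using assms(2-4) H1_derivD(1)[OF assms(1)] by (auto intro: set_integrable_subset)
qed fact

text \<open>The squared form of 1/2-Hoelder continuity, with a constant that depends on
  \<open>u\<close> only through its kinetic factor. It yields continuity of one curve and
  equicontinuity of a family with bounded kinetic factor.\<close>

lemma H1_holder: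
  assumes "H1 u" "s \<in> {0..1}" "t \<in> {0..1}"
  shows "ennreal ((cmod (u t - u s))\<^sup>2) \<le> ennreal \<bar>t - s\<bar> * kinetic u"
proof -
  obtain w where w: "H1_deriv u w" using assms by (auto simp: H1_def)
  have *: "ennreal ((cmod (u t - u s))\<^sup>2) \<le> ennreal \<bar>t - s\<bar> * kinetic u" if "0 \<le> s" "s \<le> t" "t \<le> 1" for s t
  proof -
    have "(\<integral>\<^sup>+ r\<in>{s<..t}. ennreal ((cmod (w r))\<^sup>2) \<partial>lborel) \<le> kinetic u"
      unfolding kinetic_eq[OF w] using that by (intro nn_integral_mono) (auto split: split_indicator)
    then have "ennreal (t - s) * (\<integral>\<^sup>+ r\<in>{s<..t}. ennreal ((cmod (w r))\<^sup>2) \<partial>lborel) \<le> ennreal \<bar>t - s\<bar> * kinetic u"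
      using that by (intro mult_mono) simp_all
    then show ?thesis
      by (rule order_trans[OF H1_deriv_norm_increment[OF w that]])
  qed
  show ?thesis
    using *[of s t] *[of t s] assms by (cases "s \<le> t") (auto simp: norm_minus_commute abs_minus_commute)
qed

lemma kinetic_finite: "H1 u \<Longrightarrow> kinetic u < \<infinity>"
  unfolding H1_def by (metis H1_derivD(2) kinetic_eq)

lemma H1_continuous:
  assumes "H1 u" shows "continuous_on {0..1} u"
proof -
  obtain w where w: "H1_deriv u w" using assms by (auto simp: H1_def)
  obtain C where C: "kinetic u = ennreal C" "C \<ge> 0"
    using kinetic_finite[OF assms] by (cases "kinetic u") auto
  have b: "cmod (u t - u s) \<le> sqrt (\<bar>t - s\<bar> * C)" if "s \<in> {0..1}" "t \<in> {0..1}" for s t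
  proof (rule real_le_rsqrt)
    have "ennreal ((cmod (u t - u s))\<^sup>2) \<le> ennreal (\<bar>t - s\<bar> * C)"
      using H1_holder[OF assms that] C by (simp add: ennreal_mult)
    then show "(cmod (u t - u s))\<^sup>2 \<le> \<bar>t - s\<bar> * C" using C by (simp add: ennreal_le_iff)
  qed
  show ?thesis unfolding continuous_on_def
  proof
    fix s :: real assume s: "s \<in> {0..1}"
    have "((\<lambda>t. u t - u s) \<longlongrightarrow> 0) (at s within {0..1})"
    proof (rule Lim_null_comparison)
      show "\<forall>\<^sub>F t in at s within {0..1}. cmod (u t - u s) \<le> sqrt (\<bar>t - s\<bar> * C)"
        using b[OF s] by (auto simp: eventually_at_filter)
      have "((\<lambda>t. sqrt (\<bar>t - s\<bar> * C)) \<longlongrightarrow> sqrt (\<bar>s - s\<bar> * C)) (at s within {0..1})"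
        by (intro tendsto_intros)
      then show "((\<lambda>t. sqrt (\<bar>t - s\<bar> * C)) \<longlongrightarrow> 0) (at s within {0..1})" by simp
    qed
    then show "(u \<longlongrightarrow> u s) (at s within {0..1})" by (simp add: LIM_zero_iff)
  qed
qed

section \<open>Dyadic energies\<close>

definition dyadic_inc :: "(real \<Rightarrow> complex) \<Rightarrow> nat \<Rightarrow> nat \<Rightarrow> complex" where
  "dyadic_inc u m i = u (real (Suc i) / 2^m) - u (real i / 2^m)"

text \<open>On \<open>{0..<1}\<close> this is the slope of the piecewise linear interpolant of
  \<open>u\<close> at the nodes of level \<open>m\<close>. At \<open>s = 1\<close> the index would
  run past the last interval, hence the indicators of \<open>{0..<1}\<close> below.\<close>

definition dyadic_quot :: "(real \<Rightarrow> complex) \<Rightarrow> nat \<Rightarrow> real \<Rightarrow> complex" where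
  "dyadic_quot u m s = 2^m * dyadic_inc u m (nat \<lfloor>2^m * s\<rfloor>)"

text \<open>The Dirichlet energy of that interpolant, written without an integral so that it visibly
  depends on finitely many values of \<open>u\<close>.\<close>

definition dyadic_energy :: "(real \<Rightarrow> complex) \<Rightarrow> nat \<Rightarrow> real" where
  "dyadic_energy u m = (\<Sum>i<2^m. 2^m * (cmod (dyadic_inc u m i))\<^sup>2)"

section \<open>Martingale identities for dyadic difference quotients\<close>

lemma indicator_step:
  fixes c :: "nat \<Rightarrow> 'a :: real_vector"
  assumes "N > 0"
  shows "indicator {0..<1} s *\<^sub>R c (nat \<lfloor>real N * s\<rfloor>)
    = (\<Sum>i<N. indicator {real i / N..<real (Suc i) / N} s *\<^sub>R c i)"
proof -
  \<comment> \<open>\<open>nat\<close> sends negative floors to 0, so the index alone does not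
    exclude negative \<open>s\<close>; the condition \<open>0 \<le> s\<close> has to be carried
    along.\<close>
  have mem: "s \<in> {real i / N..<real (Suc i) / N} \<longleftrightarrow> 0 \<le> s \<and> i = nat \<lfloor>real N * s\<rfloor>" for i
  proof -
    have "s \<in> {real i / N..<real (Suc i) / N} \<longleftrightarrow> \<lfloor>real N * s\<rfloor> = int i"
      using assms by (simp add: floor_eq_iff field_simps)
    also have "\<dots> \<longleftrightarrow> 0 \<le> s \<and> i = nat \<lfloor>real N * s\<rfloor>"
      using assms by (auto simp: zero_le_mult_iff)
        (metis of_int_0_le_iff of_nat_0_le_iff of_nat_0_less_iff zero_le_floor zero_le_mult_iff linorder_not_le)
    finally show ?thesis .
  qed
  have "(\<Sum>i<N. indicator {real i / N..<real (Suc i) / N} s *\<^sub>R c i)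
      = (\<Sum>i<N. if i = nat \<lfloor>real N * s\<rfloor> then (if 0 \<le> s then c i else 0) else 0)"
    by (intro sum.cong refl) (simp only: indicator_def mem, auto)
  also have "\<dots> = (if nat \<lfloor>real N * s\<rfloor> < N \<and> 0 \<le> s then c (nat \<lfloor>real N * s\<rfloor>) else 0)"
    by (simp add: sum.delta)
  also have "nat \<lfloor>real N * s\<rfloor> < N \<and> 0 \<le> s \<longleftrightarrow> s \<in> {0..<1}"
    using assms by (auto simp: nat_less_iff floor_less_iff, metis mult.right_neutral mult_less_cancel_left_pos of_nat_0_less_iff)
  finally show ?thesis by simp
qed

lemma has_bochner_integral_step:
  fixes c :: "nat \<Rightarrow> 'a :: {banach, second_countable_topology}"
  assumes "N > 0"
  shows "has_bochner_integral lborel (\<lambda>s. indicator {0..<1} s *\<^sub>R c (nat \<lfloor>real N * s\<rfloor>)) (\<Sum>i<N. c i /\<^sub>R real N)"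
  unfolding indicator_step[OF assms]
proof (rule has_bochner_integral_sum)
  fix i
  have "has_bochner_integral lborel (indicat_real {real i / real N..<real (Suc i) / real N}) (1 / real N)"
    using has_bochner_integral_real_indicator[of "{real i / real N..<real (Suc i) / real N}" lborel]
    by (simp add: divide_right_mono diff_divide_distrib[symmetric])
  then have "has_bochner_integral lborel (\<lambda>s. indicat_real {real i / real N..<real (Suc i) / real N} s *\<^sub>R c i) ((1 / real N) *\<^sub>R c i)"
    by (rule has_bochner_integral_scaleR_left)
  then show "has_bochner_integral lborel (\<lambda>s. indicat_real {real i / real N..<real (Suc i) / real N} s *\<^sub>R c i) (c i /\<^sub>R real N)"
    by (simp add: inverse_eq_divide)
qed

lemmas has_bochner_integral_dyadic_step = has_bochner_integral_step[of "2^m" for m, simplified]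

lemma sum_lessThan_double: "(\<Sum>j<2*M. f j) = (\<Sum>i<M. f (2*i) + f (2*i+1))" for f :: "nat \<Rightarrow> 'a::comm_monoid_add"
  by (induction M) (simp_all add: add.assoc)

lemma dyadic_inc_split: "dyadic_inc u m i = dyadic_inc u (Suc m) (2*i) + dyadic_inc u (Suc m) (2*i+1)"
proof -
  have "real (Suc (Suc (2*i))) / 2 ^ Suc m = real (Suc i) / 2 ^ m" "real (2*i) / 2 ^ Suc m = real i / 2 ^ m"
    by (simp_all add: field_simps)
  then show ?thesis by (simp add: dyadic_inc_def)
qed

text \<open>The index \<open>j div 2^d\<close> is the level-\<open>n\<close> interval containing the
  fine interval \<open>j\<close>. The weight is thus constant on each coarse interval, and the fine
  increments inside it add up to the coarse one.\<close>

lemma sum_dyadic_inc_mult: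
  "(\<Sum>j<2^(n+d). dyadic_inc u (n+d) j * G (j div 2^d)) = (\<Sum>i<2^n. dyadic_inc u n i * G i)"
proof (induction d)
  case 0 show ?case by simp
next
  case (Suc d)
  have div: "2 * i div 2 ^ Suc d = i div 2^d" "(2 * i + 1) div 2 ^ Suc d = i div 2^d" for i :: nat
    by (simp_all add: div_mult2_eq)
  have "(\<Sum>j<2^(n+Suc d). dyadic_inc u (n+Suc d) j * G (j div 2^Suc d))
    = (\<Sum>i<2^(n+d). dyadic_inc u (Suc (n+d)) (2*i) * G (2*i div 2^Suc d)
        + dyadic_inc u (Suc (n+d)) (2*i+1) * G ((2*i+1) div 2^Suc d))"
    using sum_lessThan_double[of "\<lambda>j. dyadic_inc u (n+Suc d) j * G (j div 2^Suc d)" "2^(n+d)"] by simp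
  also have "\<dots> = (\<Sum>i<2^(n+d). dyadic_inc u (n+d) i * G (i div 2^d))"
    unfolding div dyadic_inc_split[of u "n+d"] by (simp add: distrib_right)
  finally show ?case using Suc by simp
qed

lemma floor_dyadic_div: "nat \<lfloor>2^n * s\<rfloor> = nat \<lfloor>2^(n+d) * s\<rfloor> div 2^d" for s :: real
proof -
  have "\<lfloor>2^n * s\<rfloor> = \<lfloor>(2^(n+d) * s) / real_of_int (2^d)\<rfloor>" by (simp add: power_add)
  also have "\<dots> = \<lfloor>2^(n+d) * s\<rfloor> div 2^d" by (rule floor_divide_real_eq_div) simp
  finally show ?thesis by (simp add: nat_div_distrib' nat_power_eq)
qed

text \<open>The martingale property in integrated form: tested against a function of the
  level-\<open>n\<close> interval, all finer quotients give the same value. The choices of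
  \<open>G\<close> used later are a constant, the indicator of the first \<open>i\<close> intervals,
  and the conjugate of the level-\<open>n\<close> quotient.\<close>

lemma dyadic_quot_martingale:
  assumes "n \<le> m"
  shows "has_bochner_integral lborel (\<lambda>s. indicator {0..<1} s *\<^sub>R (dyadic_quot u m s * G (nat \<lfloor>2^n * s\<rfloor>)))
    (\<Sum>i<2^n. dyadic_inc u n i * G i)"
proof -
  obtain d where m: "m = n + d" using assms le_Suc_ex by blast
  have "has_bochner_integral lborel
     (\<lambda>s::real. indicator {0..<1} s *\<^sub>R (\<lambda>j. 2^m * dyadic_inc u m j * G (j div 2^d)) (nat \<lfloor>2^m * s\<rfloor>))
     (\<Sum>j<2^m. (2^m * dyadic_inc u m j * G (j div 2^d)) /\<^sub>R 2^m)"
    by (rule has_bochner_integral_dyadic_step)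
  also have "(\<Sum>j<2^m. (2^m * dyadic_inc u m j * G (j div 2^d)) /\<^sub>R 2^m) = (\<Sum>j<2^m. dyadic_inc u m j * G (j div 2^d))"
    by (intro sum.cong refl) (simp add: scaleR_conv_of_real)
  also have "\<dots> = (\<Sum>i<2^n. dyadic_inc u n i * G i)" unfolding m by (rule sum_dyadic_inc_mult)
  finally show ?thesis by (simp add: dyadic_quot_def m floor_dyadic_div[of n _ d])
qed

lemma dyadic_quot_square:
  "has_bochner_integral lborel (\<lambda>s. indicator {0..<1} s *\<^sub>R (cmod (dyadic_quot u m s))\<^sup>2) (dyadic_energy u m)"
proof -
  have "has_bochner_integral lborel
     (\<lambda>s::real. indicator {0..<1} s *\<^sub>R (\<lambda>j. (cmod (2^m * dyadic_inc u m j))\<^sup>2) (nat \<lfloor>2^m * s\<rfloor>))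
     (\<Sum>j<2^m. (cmod (2^m * dyadic_inc u m j))\<^sup>2 /\<^sub>R 2^m)"
    by (rule has_bochner_integral_dyadic_step)
  also have "(\<Sum>j<2^m. (cmod (2^m * dyadic_inc u m j))\<^sup>2 /\<^sub>R 2^m) = dyadic_energy u m"
    unfolding dyadic_energy_def
    by (intro sum.cong refl) (simp add: norm_mult norm_power power_mult_distrib power2_eq_square)
  finally show ?thesis by (simp add: dyadic_quot_def)
qed

text \<open>Testing the level-\<open>m\<close> quotient against the conjugate of the
  level-\<open>n\<close> one gives the level-\<open>n\<close> energy as cross term. Expanding the
  square leaves the difference of the energies.\<close>

lemma dyadic_quot_diff:
  assumes "n \<le> m"
  shows "has_bochner_integral lborel
    (\<lambda>s. indicator {0..<1} s *\<^sub>R (cmod (dyadic_quot u m s - dyadic_quot u n s))\<^sup>2)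
    (dyadic_energy u m - dyadic_energy u n)"
proof -
  have "has_bochner_integral lborel
      (\<lambda>s. Re (indicator {0..<1} s *\<^sub>R (dyadic_quot u m s * cnj (dyadic_quot u n s))))
      (Re (\<Sum>i<2^n. dyadic_inc u n i * cnj (2^n * dyadic_inc u n i)))"
    using dyadic_quot_martingale[OF assms, of u "\<lambda>i. cnj (2^n * dyadic_inc u n i)"]
    by (intro has_bochner_integral_Re) (simp add: dyadic_quot_def)
  also have "Re (\<Sum>i<2^n. dyadic_inc u n i * cnj (2^n * dyadic_inc u n i)) = dyadic_energy u n"
  proof -
    have "dyadic_inc u n i * cnj (2^n * dyadic_inc u n i) = of_real (2^n * (cmod (dyadic_inc u n i))\<^sup>2)" for i
      by (simp only: complex_cnj_mult complex_cnj_power complex_cnj_numeral mult.left_commute[of _ "2^n"]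
        complex_norm_square[symmetric]) simp
    then show ?thesis by (simp only: dyadic_energy_def Re_sum Re_complex_of_real)
  qed
  finally have 1: "has_bochner_integral lborel
      (\<lambda>s. 2 * Re (indicator {0..<1} s *\<^sub>R (dyadic_quot u m s * cnj (dyadic_quot u n s)))) (2 * dyadic_energy u n)"
    by (rule has_bochner_integral_mult_right[OF _]) 
  have pw: "indicator {0..<1} s *\<^sub>R (cmod (dyadic_quot u m s))\<^sup>2 + indicator {0..<1} s *\<^sub>R (cmod (dyadic_quot u n s))\<^sup>2
      - 2 * Re (indicator {0..<1} s *\<^sub>R (dyadic_quot u m s * cnj (dyadic_quot u n s)))
      = indicator {0..<1} s *\<^sub>R (cmod (dyadic_quot u m s - dyadic_quot u n s))\<^sup>2" for s
  proof -
    have "(cmod (a - b))\<^sup>2 = (cmod a)\<^sup>2 + (cmod b)\<^sup>2 - 2 * Re (a * cnj b)" for a b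
      by (simp add: cmod_power2) (simp add: power2_eq_square algebra_simps)
    then show ?thesis by (simp split: split_indicator)
  qed
  show ?thesis
    using has_bochner_integral_diff[OF has_bochner_integral_add[OF dyadic_quot_square[of u m] dyadic_quot_square[of u n]] 1]
    unfolding pw by simp
qed

lemma dyadic_energy_mono: "n \<le> m \<Longrightarrow> dyadic_energy u n \<le> dyadic_energy u m"
  using has_bochner_integral_integral_eq[OF dyadic_quot_diff, of n m u]
    Bochner_Integration.integral_nonneg[of lborel "\<lambda>s. indicator {0..<1} s *\<^sub>R (cmod (dyadic_quot u m s - dyadic_quot u n s))\<^sup>2"]
  by simp

text \<open>By Cauchy-Schwarz on each dyadic interval, the length \<open>1 / 2^m\<close> cancels the
  factor \<open>2^m\<close>; the intervals are disjoint, so the local integrals add up to at most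
  the whole one.\<close>

lemma dyadic_energy_le_kinetic:
  assumes "H1 u"
  shows "ennreal (dyadic_energy u m) \<le> kinetic u"
proof -
  obtain w where w: "H1_deriv u w" using assms by (auto simp: H1_def)
  have set_integrable: "set_integrable lborel {0..1} w" by (rule H1_derivD[OF w])
  \<comment> \<open>Measurability of \<open>w\<close> is known only after restriction to
    \<open>{0..1}\<close>, so the cut-off is built into \<open>f\<close>.\<close>
  define f where "f = (\<lambda>s. ennreal ((cmod (indicator {0..1::real} s *\<^sub>R w s))\<^sup>2))"
  have [measurable]: "(\<lambda>s. indicator {0..1::real} s *\<^sub>R w s) \<in> borel_measurable borel"
    using set_integrable by (auto simp: set_integrable_def dest: borel_measurable_integrable)
  have [measurable]: "f \<in> borel_measurable borel" unfolding f_def by measurable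
  define J where "J = (\<lambda>i. {real i / 2^m<..real (Suc i) / 2^m})"
  have "ennreal (2^m * (cmod (dyadic_inc u m i))\<^sup>2) \<le> (\<integral>\<^sup>+ r. f r * indicator (J i) r \<partial>lborel)" if "i < 2^m" for i
  proof -
    have le: "0 \<le> real i / 2^m" "real i / 2^m \<le> real (Suc i) / 2^m" "real (Suc i) / 2^m \<le> 1"
    proof -
      have "real (Suc i) \<le> real (2^m)" using that by (subst of_nat_le_iff) simp
      then show "real (Suc i) / 2^m \<le> 1" by simp
    qed (simp_all add: divide_right_mono)
    have eq: "real (Suc i) / 2^m - real i / 2^m = 1 / 2^m" by (simp add: field_simps)
    have "ennreal (2^m * (cmod (dyadic_inc u m i))\<^sup>2) = ennreal (2^m) * ennreal ((cmod (dyadic_inc u m i))\<^sup>2)"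
      by (simp add: ennreal_mult)
    also have "\<dots> \<le> ennreal (2^m) * (ennreal (1/2^m) * (\<integral>\<^sup>+ r\<in>J i. ennreal ((cmod (w r))\<^sup>2) \<partial>lborel))"
      using H1_deriv_norm_increment[OF w le] unfolding eq J_def dyadic_inc_def by (intro mult_left_mono) auto
    also have "\<dots> = (\<integral>\<^sup>+ r\<in>J i. ennreal ((cmod (w r))\<^sup>2) \<partial>lborel)"
      by (simp add: mult.assoc[symmetric] flip: ennreal_mult)
    also have "\<dots> = (\<integral>\<^sup>+ r. f r * indicator (J i) r \<partial>lborel)"
    proof -
      have "J i \<subseteq> {0..1}" using le unfolding J_def 
        by (meson atLeastAtMost_iff greaterThanAtMost_iff le(1,3) less_imp_le order_trans subsetI)
      then show ?thesis by (intro nn_integral_cong) (auto simp: f_def indicator_def subset_iff)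
    qed
    finally show ?thesis .
  qed
  then have "(\<Sum>i<2^m. ennreal (2^m * (cmod (dyadic_inc u m i))\<^sup>2)) \<le> (\<Sum>i<2^m. \<integral>\<^sup>+ r. f r * indicator (J i) r \<partial>lborel)"
    by (intro sum_mono) auto
  also have "\<dots> = (\<integral>\<^sup>+ r. (\<Sum>i<2^m. f r * indicator (J i) r) \<partial>lborel)"
    by (intro nn_integral_sum[symmetric]) (auto simp: J_def)
  also have "\<dots> \<le> (\<integral>\<^sup>+ r\<in>{0..1}. ennreal ((cmod (w r))\<^sup>2) \<partial>lborel)"
  proof (rule nn_integral_mono)
    fix r :: real
    have "disjoint_family_on J {..<2^m}"
      unfolding disjoint_family_on_def
    proof (intro ballI impI)
      fix i j :: nat assume "i \<noteq> j"
      then have "Suc i \<le> j \<or> Suc j \<le> i" by auto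
      then have "real (Suc i) / 2^m \<le> real j / 2^m \<or> real (Suc j) / 2^m \<le> real i / 2^m"
        using divide_right_mono[of "real (Suc i)" "real j" "2^m"] divide_right_mono[of "real (Suc j)" "real i" "2^m"]
        by (simp only: of_nat_le_iff) auto
      then show "J i \<inter> J j = {}" by (auto simp: J_def simp del: of_nat_Suc)
    qed
    then have "(\<Sum>i<2^m. f r * indicator (J i) r) = f r * indicator (\<Union>i<2^m. J i) r"
      by (simp add: indicator_UN_disjoint sum_distrib_left)
    also have "\<dots> \<le> f r" by (auto split: split_indicator)
    also have "f r = ennreal ((cmod (w r))\<^sup>2) * indicator {0..1} r"
      by (auto simp: f_def split: split_indicator)
    finally show "(\<Sum>i<2^m. f r * indicator (J i) r) \<le> ennreal ((cmod (w r))\<^sup>2) * indicator {0..1} r" .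
  qed
  also have "\<dots> = kinetic u" by (rule kinetic_eq[OF w, symmetric])
  finally show ?thesis by (simp add: dyadic_energy_def sum_ennreal)
qed

section \<open>From bounded dyadic energies to a weak derivative\<close>

lemma fast_Cauchy_indices:
  fixes E :: "nat \<Rightarrow> real"
  assumes "convergent E" "\<And>k. 0 < e k"
  obtains r where "mono r" "\<And>k. k \<le> r k" "\<And>k. \<bar>E (r (Suc k)) - E (r k)\<bar> < e k"
proof -
  have "Cauchy E" using assms(1) by (simp add: Cauchy_convergent_iff)
  then have "\<forall>k. \<exists>N. \<forall>m\<ge>N. \<forall>n\<ge>N. \<bar>E m - E n\<bar> < e k"
    using assms(2) unfolding Cauchy_def dist_real_def by blast
  from choice[OF this] obtain N where N: "\<And>k m n. m \<ge> N k \<Longrightarrow> n \<ge> N k \<Longrightarrow> \<bar>E m - E n\<bar> < e k" by blast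
  \<comment> \<open>Summing the thresholds makes \<open>r\<close> monotone and at least each
    \<open>N k\<close>; the extra summand gives \<open>k \<le> r k\<close>.\<close>
  define r where "r k = k + (\<Sum>j\<le>k. N j)" for k
  have Nr: "N k \<le> r k" for k unfolding r_def by (intro trans_le_add2 member_le_sum) auto
  have mr: "mono r" unfolding r_def by (intro monoI add_mono sum_mono2) auto
  show ?thesis
  proof (rule that)
    fix k
    show "\<bar>E (r (Suc k)) - E (r k)\<bar> < e k"
      by (rule N) (use Nr[of k] monoD[OF mr, of k "Suc k"] in auto)
    show "k \<le> r k" by (simp add: r_def)
  qed (rule mr)
qed

text \<open>The heart of the Riesz-Fischer argument: by monotone convergence the sum of the norms
  has finite integral, so it is finite almost everywhere.\<close>

lemma AE_summable_of_summable_integral: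
  fixes d :: "nat \<Rightarrow> 'a \<Rightarrow> 'b :: {banach, second_countable_topology}"
  assumes "\<And>k. integrable M (d k)" "summable (\<lambda>k. \<integral>x. norm (d k x) \<partial>M)"
  shows "AE x in M. summable (\<lambda>k. norm (d k x))"
proof -
  have [measurable]: "d k \<in> borel_measurable M" for k using assms(1) by auto
  have "(\<integral>\<^sup>+ x. (\<Sum>k. ennreal (norm (d k x))) \<partial>M) = (\<Sum>k. \<integral>\<^sup>+ x. ennreal (norm (d k x)) \<partial>M)"
    by (rule nn_integral_suminf) simp
  also have "\<dots> = (\<Sum>k. ennreal (\<integral>x. norm (d k x) \<partial>M))"
    using assms(1) by (intro suminf_cong nn_integral_eq_integral) auto
  also have "\<dots> \<noteq> \<infinity>"
    unfolding infinity_ennreal_def by (rule ennreal_suminf_neq_top[OF assms(2)]) simp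
  finally have "AE x in M. (\<Sum>k. ennreal (norm (d k x))) \<noteq> \<infinity>"
    by (intro nn_integral_noteq_infinite) auto
  then show ?thesis 
  proof eventually_elim
    case (elim x)
    show ?case by (rule summable_suminf_not_top) (use elim in \<open>simp_all only: norm_ge_zero infinity_ennreal_def not_False_eq_True\<close>)
  qed
qed

text \<open>
  The difference quotients on dyadic intervals form a martingale, so by Pythagoras
  (\<open>dyadic_quot_diff\<close>) boundedness of the energies makes them Cauchy in \<open>L\<^sup>2\<close>; the
  limit is the weak derivative.
\<close>

lemma H1_deriv_of_dyadic_energy_bound:
  assumes cont: "continuous_on {0..1} u" and bound: "\<And>m. dyadic_energy u m \<le> K"
  shows "\<exists>w. H1_deriv u w \<and> (\<integral>\<^sup>+ s\<in>{0..1}. ennreal ((cmod (w s))\<^sup>2) \<partial>lborel) \<le> ennreal K"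
proof -
  define E where "E = dyadic_energy u"
  have "incseq E" unfolding E_def by (intro monoI dyadic_energy_mono)
  then obtain l where "E \<longlonglongrightarrow> l"
    by (rule incseq_convergent[of E K]) (use bound in \<open>auto simp: E_def\<close>)
  then have "convergent E" by (rule convergentI)
  \<comment> \<open>By Pythagoras the energy gap is a squared \<open>L2\<close> distance, so a gap
    below \<open>(1/4)^k\<close> means a distance below \<open>(1/2)^k\<close>, which is
    summable.\<close>
  then obtain r where r: "mono r" "\<And>k. k \<le> r k" and rE: "\<And>k. \<bar>E (r (Suc k)) - E (r k)\<bar> < (1/4)^k"
    by (rule fast_Cauchy_indices[where e = "\<lambda>k. (1/4)^k"]) auto
  define f where "f k s = indicator {0..<1} s *\<^sub>R dyadic_quot u (r k) s" for k s
  have f: "integrable lborel (f k)" for k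
    using dyadic_quot_martingale[of 0 "r k" u "\<lambda>_. 1"]
    by (auto simp: f_def[abs_def] has_bochner_integral_iff)
  have [measurable]: "f k \<in> borel_measurable borel" for k
    using borel_measurable_integrable[OF f] by simp
  define d where "d k s = f (Suc k) s - f k s" for k s
  have d: "integrable lborel (d k)" for k
    unfolding d_def[abs_def] using f by auto
  have dL1: "(\<integral>s. norm (d k s) \<partial>lborel) \<le> (1/2)^k" for k
  proof -
    let ?q = "\<lambda>s. indicator {0..<1} s *\<^sub>R (cmod (dyadic_quot u (r (Suc k)) s - dyadic_quot u (r k) s))\<^sup>2"
    have q: "has_bochner_integral lborel ?q (E (r (Suc k)) - E (r k))"
      unfolding E_def by (rule dyadic_quot_diff) (use r in \<open>auto intro: monoD\<close>)
    have i: "has_bochner_integral lborel (indicat_real {0..<1::real}) 1"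
      using has_bochner_integral_real_indicator[of "{0..<1::real}" lborel] by simp
    have "(\<integral>s. norm (d k s) \<partial>lborel) \<le> (\<integral>s. 2^k / 2 * ?q s + (1/2)^k / 2 * indicator {0..<1} s \<partial>lborel)"
    proof (rule integral_mono)
      show "integrable lborel (\<lambda>s. 2^k / 2 * ?q s + (1/2)^k / 2 * indicator {0..<1} s)"
        using q i by (intro Bochner_Integration.integrable_add integrable_mult_right) (auto simp: has_bochner_integral_iff)
      fix s :: real
      \<comment> \<open>A weighted AM-GM inequality passes from \<open>L2\<close> to
        \<open>L1\<close>. The weight \<open>2^k\<close> is balanced against the gap
        \<open>(1/4)^k\<close>, so that both terms integrate to at most
        \<open>(1/2)^k / 2\<close>.\<close>
      have am_gm: "x \<le> 2^k / 2 * x\<^sup>2 + (1/2)^k / 2" for x :: real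
      proof -
        have "0 \<le> (2^k * x - 1)\<^sup>2" by simp
        then show ?thesis by (simp add: power2_eq_square field_simps)
      qed
      show "norm (d k s) \<le> 2^k / 2 * ?q s + (1/2)^k / 2 * indicator {0..<1} s"
        using am_gm[of "cmod (dyadic_quot u (r (Suc k)) s - dyadic_quot u (r k) s)"]
        by (auto simp: d_def f_def split: split_indicator)
    qed (use d in auto)
    also have "\<dots> = 2^k / 2 * (E (r (Suc k)) - E (r k)) + (1/2)^k / 2"
      using q i by (subst Bochner_Integration.integral_add) (auto simp: has_bochner_integral_iff)
    also have "\<dots> \<le> 2^k / 2 * (1/4)^k + (1/2)^k / 2"
      using rE[of k] by (intro add_mono mult_left_mono) auto
    also have "2^k / 2 * (1/4)^k = (1/2::real)^k / 2"
      by (simp flip: power_mult_distrib)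
    finally show ?thesis by simp
  qed
  have sum_d: "summable (\<lambda>k. \<integral>s. norm (d k s) \<partial>lborel)"
    by (rule summable_comparison_test'[where g = "\<lambda>k. (1/2)^k" and N = 0]) (use dL1 in auto)
  have AE_d: "AE s in lborel. summable (\<lambda>k. norm (d k s))"
    by (rule AE_summable_of_summable_integral[OF d sum_d])
  \<comment> \<open>The telescoping series makes \<open>w\<close> the almost everywhere limit of
    \<open>f k\<close> and lets series theorems supply its integrability.\<close>
  define w where "w s = f 0 s + (\<Sum>k. d k s)" for s
  have tele: "(\<Sum>j<k. d j s) = f k s - f 0 s" for k s
    unfolding d_def by (rule sum_lessThan_telescope[of "\<lambda>j. f j s"])
  have f_w: "AE s in lborel. (\<lambda>k. f k s) \<longlonglongrightarrow> w s"
    using AE_d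
  proof eventually_elim
    case (elim s)
    from summable_LIMSEQ[OF summable_norm_cancel[OF elim]]
    have "(\<lambda>k. f k s - f 0 s) \<longlonglongrightarrow> (\<Sum>k. d k s)" by (simp add: tele)
    from tendsto_add[OF tendsto_const[of "f 0 s"] this] show ?case by (simp add: w_def)
  qed
  have w: "integrable lborel w"
    unfolding w_def[abs_def] using f d AE_d sum_d
    by (intro Bochner_Integration.integrable_add integrable_suminf) auto
  have [measurable]: "w \<in> borel_measurable borel" using borel_measurable_integrable[OF w] by simp
  \<comment> \<open>Integrals over any Borel set converge as well: the restricted differences are
    dominated term by term by the unrestricted ones, so the series may be integrated
    termwise.\<close>
  have int_w: "(\<lambda>k. LINT s:A|lborel. f k s) \<longlonglongrightarrow> (LINT s:A|lborel. w s)" if [measurable]: "A \<in> sets borel" for A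
  proof -
    let ?I = "indicat_real A"
    have le: "norm (?I s *\<^sub>R d k s) \<le> norm (d k s)" for k s by (auto split: split_indicator)
    have fA: "integrable lborel (\<lambda>s. ?I s *\<^sub>R f k s)" for k using f by (intro integrable_mult_indicator) auto
    have dA: "integrable lborel (\<lambda>s. ?I s *\<^sub>R d k s)" for k using d by (intro integrable_mult_indicator) auto
    have AE_A: "AE s in lborel. summable (\<lambda>k. norm (?I s *\<^sub>R d k s))"
      using AE_d
    proof eventually_elim
      case (elim s)
      show ?case by (rule summable_comparison_test'[OF elim, of 0]) (use le in \<open>simp only: real_norm_def abs_norm_cancel\<close>)
    qed
    have sum_A: "summable (\<lambda>k. \<integral>s. norm (?I s *\<^sub>R d k s) \<partial>lborel)"
    proof (rule summable_comparison_test'[OF sum_d])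
      fix k
      show "norm (\<integral>s. norm (?I s *\<^sub>R d k s) \<partial>lborel) \<le> (\<integral>s. norm (d k s) \<partial>lborel)"
        using dA[of k] d[of k] le by (simp add: integral_mono del: norm_scaleR)
    qed
    have "(\<lambda>k. \<Sum>j<k. \<integral>s. ?I s *\<^sub>R d j s \<partial>lborel) \<longlonglongrightarrow> (\<integral>s. (\<Sum>k. ?I s *\<^sub>R d k s) \<partial>lborel)"
      using sums_integral[OF dA AE_A sum_A] by (simp add: sums_def)
    moreover have "(\<Sum>j<k. \<integral>s. ?I s *\<^sub>R d j s \<partial>lborel) = (LINT s:A|lborel. f k s) - (LINT s:A|lborel. f 0 s)" for k
    proof -
      have "(\<Sum>j<k. \<integral>s. ?I s *\<^sub>R d j s \<partial>lborel) = (\<integral>s. (\<Sum>j<k. ?I s *\<^sub>R d j s) \<partial>lborel)"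
        using dA by (intro Bochner_Integration.integral_sum[symmetric]) auto
      also have "\<dots> = (\<integral>s. ?I s *\<^sub>R f k s - ?I s *\<^sub>R f 0 s \<partial>lborel)"
        by (simp add: tele scaleR_diff_right flip: scaleR_sum_right)
      also have "\<dots> = (LINT s:A|lborel. f k s) - (LINT s:A|lborel. f 0 s)"
        unfolding set_lebesgue_integral_def using fA by (rule Bochner_Integration.integral_diff[OF _ fA])
      finally show ?thesis .
    qed
    moreover have "(\<integral>s. (\<Sum>k. ?I s *\<^sub>R d k s) \<partial>lborel) = (LINT s:A|lborel. w s) - (LINT s:A|lborel. f 0 s)"
    proof -
      have "(\<Sum>k. ?I s *\<^sub>R d k s) = ?I s *\<^sub>R w s - ?I s *\<^sub>R f 0 s" for s
        by (auto simp: w_def split: split_indicator)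
      then have "(\<integral>s. (\<Sum>k. ?I s *\<^sub>R d k s) \<partial>lborel) = (\<integral>s. ?I s *\<^sub>R w s - ?I s *\<^sub>R f 0 s \<partial>lborel)"
        by simp
      also have "\<dots> = (LINT s:A|lborel. w s) - (LINT s:A|lborel. f 0 s)"
        unfolding set_lebesgue_integral_def using w
        by (intro Bochner_Integration.integral_diff fA integrable_mult_indicator) auto
      finally show ?thesis .
    qed
    ultimately have "(\<lambda>k. (LINT s:A|lborel. f k s) - (LINT s:A|lborel. f 0 s)) \<longlonglongrightarrow> (LINT s:A|lborel. w s) - (LINT s:A|lborel. f 0 s)"
      by simp
    from tendsto_add[OF this tendsto_const[of "LINT s:A|lborel. f 0 s"]] show ?thesis by simp
  qed
  have dyadic: "(LINT s:{0..<real i / 2^n}|lborel. w s) = u (real i / 2^n) - u 0" if i: "i \<le> 2^n" for i n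
  proof (rule LIMSEQ_unique[OF int_w])
    have "(LINT s:{0..<real i / 2^n}|lborel. f k s) = u (real i / 2^n) - u 0" if "k \<ge> n" for k
    proof -
      \<comment> \<open>Testing with the indicator of the first \<open>i\<close> intervals of level
        \<open>n\<close> shows that the integrals already have their final value once
        \<open>k \<ge> n\<close>; the limit is that of an eventually constant sequence.\<close>
      let ?G = "\<lambda>j. if j < i then 1 else 0 :: complex"
      have "real i \<le> real (2^n)" using i by (simp only: of_nat_le_iff)
      then have "real i / 2^n \<le> 1" by simp
      moreover have "nat \<lfloor>2^n * s\<rfloor> < i \<longleftrightarrow> s < real i / 2^n" if "0 \<le> s" for s :: real
        using that by (simp add: nat_less_iff floor_less_iff field_simps)
      ultimately have pw: "indicator {0..<real i / 2^n} s *\<^sub>R f k s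
          = indicator {0..<1} s *\<^sub>R (dyadic_quot u (r k) s * ?G (nat \<lfloor>2^n * s\<rfloor>))" for s :: real
        by (auto simp: f_def split: split_indicator)
      have "n \<le> r k" using that r(2)[of k] by simp
      from has_bochner_integral_integral_eq[OF dyadic_quot_martingale[OF this, of u ?G]]
      have "(LINT s:{0..<real i / 2^n}|lborel. f k s) = (\<Sum>j<2^n. dyadic_inc u n j * ?G j)"
        unfolding set_lebesgue_integral_def pw .
      also have "\<dots> = (\<Sum>j<i. dyadic_inc u n j)"
        using i by (intro sum.mono_neutral_cong_right) auto
      also have "\<dots> = u (real i / 2^n) - u 0"
        using sum_lessThan_telescope[of "\<lambda>j. u (real j / 2^n)" i] by (simp add: dyadic_inc_def)
      finally show ?thesis .
    qed
    then show "(\<lambda>k. LINT s:{0..<real i / 2^n}|lborel. f k s) \<longlonglongrightarrow> u (real i / 2^n) - u 0"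
      by (intro tendsto_eventually eventually_sequentiallyI)
  qed simp
  have eq: "u t = u 0 + (LINT s:{0..t}|lborel. w s)" if t: "t \<in> {0..1}" for t
  proof -
    \<comment> \<open>The last node of level \<open>n\<close> that does not exceed \<open>t\<close>;
      the identity at nodes is carried to \<open>t\<close> by continuity of \<open>u\<close> on one
      side and dominated convergence on the other.\<close>
    define \<tau> where "\<tau> n = real (nat \<lfloor>2^n * t\<rfloor>) / 2^n" for n :: nat
    have \<tau>_le: "\<tau> n \<le> t" "0 \<le> \<tau> n" "t - (1/2)^n \<le> \<tau> n" for n
    proof -
      have "0 \<le> 2^n * t" using t by simp
      then have b: "real (nat \<lfloor>2^n * t\<rfloor>) \<le> 2^n * t" "2^n * t - 1 \<le> real (nat \<lfloor>2^n * t\<rfloor>)" by linarith+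
      show "\<tau> n \<le> t" "0 \<le> \<tau> n" using b(1) by (simp_all add: \<tau>_def field_simps)
      have "t - (1/2)^n = (2^n * t - 1) / 2^n" by (simp add: field_simps power_one_over)
      also have "\<dots> \<le> \<tau> n" unfolding \<tau>_def using b(2) by (rule divide_right_mono) simp
      finally show "t - (1/2)^n \<le> \<tau> n" .
    qed
    have \<tau>: "\<tau> \<longlonglongrightarrow> t"
    proof (rule real_tendsto_sandwich)
      have "(\<lambda>n. t - (1/2)^n) \<longlonglongrightarrow> t - 0"
        by (intro tendsto_intros LIMSEQ_power_zero) simp
      then show "(\<lambda>n. t - (1/2)^n) \<longlonglongrightarrow> t" by simp
    qed (use \<tau>_le in auto)
    have mem: "\<tau> n \<in> {0..1}" for n
      using t \<tau>_le(1,2)[of n] by auto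
    have lim1: "(\<lambda>n. u (\<tau> n) - u 0) \<longlonglongrightarrow> u t - u 0"
      using t mem by (intro tendsto_diff tendsto_const continuous_on_tendsto_compose[OF cont \<tau>] always_eventually) auto
    have inc: "u (\<tau> n) - u 0 = (LINT s:{0..<\<tau> n}|lborel. w s)" for n
    proof -
      have "real (nat \<lfloor>2^n * t\<rfloor>) \<le> real (2^n)"
        using mem[of n] by (simp add: \<tau>_def)
      then have "nat \<lfloor>2^n * t\<rfloor> \<le> 2^n" by (simp only: of_nat_le_iff)
      from dyadic[OF this] show ?thesis by (simp add: \<tau>_def)
    qed
    \<comment> \<open>As the nodes approach from the left and the intervals are right-open, the
      indicators agree eventually at every point, including \<open>s = t\<close>.\<close>
    have lim2: "(\<lambda>n. LINT s:{0..<\<tau> n}|lborel. w s) \<longlonglongrightarrow> (LINT s:{0..<t}|lborel. w s)"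
      unfolding set_lebesgue_integral_def
    proof (rule integral_dominated_convergence[where w = "\<lambda>s. norm (w s)"])
      show "AE s in lborel. (\<lambda>n. indicat_real {0..<\<tau> n} s *\<^sub>R w s) \<longlonglongrightarrow> indicat_real {0..<t} s *\<^sub>R w s"
      proof (rule AE_I2)
        fix s
        have "\<forall>\<^sub>F n in sequentially. indicat_real {0..<\<tau> n} s *\<^sub>R w s = indicat_real {0..<t} s *\<^sub>R w s"
        proof (cases "s < t")
          case True
          with \<tau> have "\<forall>\<^sub>F n in sequentially. s < \<tau> n" by (rule order_tendstoD)
          then show ?thesis by eventually_elim (use True in \<open>auto split: split_indicator\<close>)
        next
          case False
          then have "\<not> s < \<tau> n" for n using \<tau>_le(1)[of n] by linarith
          then show ?thesis using False by (intro always_eventually) (auto split: split_indicator)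
        qed
        then show "(\<lambda>n. indicat_real {0..<\<tau> n} s *\<^sub>R w s) \<longlonglongrightarrow> indicat_real {0..<t} s *\<^sub>R w s"
          by (rule tendsto_eventually)
      qed
      show "AE s in lborel. norm (indicat_real {0..<\<tau> n} s *\<^sub>R w s) \<le> norm (w s)" for n
        by (auto split: split_indicator)
    qed (use w in auto)
    have "u t - u 0 = (LINT s:{0..<t}|lborel. w s)"
      using lim1 lim2 unfolding inc by (rule LIMSEQ_unique)
    also have "\<dots> = (LINT s:{0..t}|lborel. w s)"
      unfolding set_lebesgue_integral_def
    proof (rule integral_cong_AE)
      have "AE s in lborel. s \<noteq> t" by (rule AE_lborel_singleton)
      then show "AE s in lborel. indicat_real {0..<t} s *\<^sub>R w s = indicat_real {0..t} s *\<^sub>R w s"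
        by eventually_elim (auto split: split_indicator)
    qed auto
    finally show ?thesis by (simp add: algebra_simps)
  qed
  \<comment> \<open>Fatou along \<open>f k\<close>, whose squared norms integrate to
    \<open>E (r k)\<close>, hence to at most \<open>K\<close>.\<close>
  have energy: "(\<integral>\<^sup>+ s\<in>{0..1}. ennreal ((cmod (w s))\<^sup>2) \<partial>lborel) \<le> ennreal K"
  proof -
    have "(\<integral>\<^sup>+ s\<in>{0..1}. ennreal ((cmod (w s))\<^sup>2) \<partial>lborel) \<le> (\<integral>\<^sup>+ s. liminf (\<lambda>k. ennreal ((cmod (f k s))\<^sup>2)) \<partial>lborel)"
    proof (rule nn_integral_mono_AE)
      show "AE s in lborel. ennreal ((cmod (w s))\<^sup>2) * indicator {0..1} s \<le> liminf (\<lambda>k. ennreal ((cmod (f k s))\<^sup>2))"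
        using f_w
      proof eventually_elim
        case (elim s)
        then have "(\<lambda>k. ennreal ((cmod (f k s))\<^sup>2)) \<longlonglongrightarrow> ennreal ((cmod (w s))\<^sup>2)"
          by (intro tendsto_ennrealI tendsto_intros)
        then have "liminf (\<lambda>k. ennreal ((cmod (f k s))\<^sup>2)) = ennreal ((cmod (w s))\<^sup>2)"
          by (intro lim_imp_Liminf) auto
        then show ?case by (auto split: split_indicator)
      qed
    qed
    also have "\<dots> \<le> liminf (\<lambda>k. \<integral>\<^sup>+ s. ennreal ((cmod (f k s))\<^sup>2) \<partial>lborel)"
      by (rule nn_integral_liminf) simp
    also have "\<dots> \<le> ennreal K"
    proof (rule Liminf_le)
      have "(\<integral>\<^sup>+ s. ennreal ((cmod (f k s))\<^sup>2) \<partial>lborel) = ennreal (E (r k))" for k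
      proof -
        have "has_bochner_integral lborel (\<lambda>s. (cmod (f k s))\<^sup>2) (E (r k))"
          using dyadic_quot_square[of u "r k"] unfolding E_def f_def
          by (rule has_bochner_integral_cong[THEN iffD1, rotated -1]) (auto split: split_indicator)
        then show ?thesis by (simp add: has_bochner_integral_iff nn_integral_eq_integral)
      qed
      then show "\<forall>\<^sub>F k in sequentially. (\<integral>\<^sup>+ s. ennreal ((cmod (f k s))\<^sup>2) \<partial>lborel) \<le> ennreal K"
        using bound by (auto simp: E_def intro!: always_eventually ennreal_leI)
    qed simp
    finally show ?thesis .
  qed
  show ?thesis
  proof (intro exI[of _ w] conjI)
    show "H1_deriv u w"
      unfolding H1_deriv_def
    proof (intro conjI ballI)
      show "set_integrable lborel {0..1} w"
        using w unfolding set_integrable_def by (intro integrable_mult_indicator) auto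
      show "(\<integral>\<^sup>+ s\<in>{0..1}. ennreal ((cmod (w s))\<^sup>2) \<partial>lborel) < \<infinity>"
        using energy by (rule order_le_less_trans) simp
    qed (rule eq)
  qed (rule energy)
qed

lemma H1_of_dyadic_energy_bound:
  assumes "continuous_on {0..1} u" "\<And>m. dyadic_energy u m \<le> K"
  shows "H1 u" "kinetic u \<le> ennreal K"
proof -
  obtain w where w: "H1_deriv u w" "(\<integral>\<^sup>+ s\<in>{0..1}. ennreal ((cmod (w s))\<^sup>2) \<partial>lborel) \<le> ennreal K"
    using H1_deriv_of_dyadic_energy_bound[OF assms] by blast
  show "H1 u" unfolding H1_def by (rule exI[of _ w]) (rule w(1))
  show "kinetic u \<le> ennreal K" unfolding kinetic_eq[OF w(1)] by (rule w(2))
qed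

lemma dyadic_node_mem: "i < 2^m \<Longrightarrow> real i / 2^m \<in> {0..1}" "i < 2^m \<Longrightarrow> real (Suc i) / 2^m \<in> {0..1}"
proof -
  assume i: "i < 2^m"
  then have "real (Suc i) \<le> real (2^m)" by (simp only: of_nat_le_iff Suc_le_eq)
  moreover from this have "real i \<le> real (2^m)" by linarith
  ultimately show "real (Suc i) / 2^m \<in> {0..1}" "real i / 2^m \<in> {0..1}" by (simp_all add: divide_le_eq)
qed

text \<open>Each of the \<open>2^m\<close> summands of the energy is at most
  \<open>C\<^sup>2 / 2^m\<close>, so the dyadic criterion applies without differentiating
  \<open>u\<close>. It serves to produce collision curves.\<close>

lemma H1_lipschitz:
  assumes "C-lipschitz_on {0..1} u"
  shows "H1 u"
proof (rule H1_of_dyadic_energy_bound)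
  show "continuous_on {0..1} u" using assms by (rule lipschitz_on_continuous_on)
  fix m
  have "2^m * (cmod (dyadic_inc u m i))\<^sup>2 \<le> C\<^sup>2 / 2^m" if "i < 2^m" for i
  proof -
    have eq: "real (Suc i) / 2^m - real i / 2^m = 1 / 2^m" by (simp add: field_simps)
    have "cmod (dyadic_inc u m i) \<le> C * norm (real (Suc i) / 2^m - real i / 2^m)"
      unfolding dyadic_inc_def by (intro lipschitz_on_normD[OF assms] dyadic_node_mem that)
    then have "cmod (dyadic_inc u m i) \<le> C / 2^m" unfolding eq by simp
    then have "(cmod (dyadic_inc u m i))\<^sup>2 \<le> (C / 2^m)\<^sup>2" by (intro power_mono) auto
    then have "2^m * (cmod (dyadic_inc u m i))\<^sup>2 \<le> 2^m * (C / 2^m)\<^sup>2" by (intro mult_left_mono) auto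
    then show ?thesis by (simp add: power2_eq_square)
  qed
  then have "dyadic_energy u m \<le> (\<Sum>i<(2::nat)^m. C\<^sup>2 / 2^m)"
    unfolding dyadic_energy_def by (intro sum_mono) auto
  then show "dyadic_energy u m \<le> C\<^sup>2" by simp
qed

section \<open>Lower semicontinuity and existence of minimizers\<close>

text \<open>Pointwise convergence suffices: every dyadic energy of \<open>u\<close> is the limit of
  those of \<open>v n\<close>, each bounded by the kinetic factor, and the criterion turns the
  common bound into membership and an estimate.\<close>

lemma kinetic_lower_semicontinuous:
  assumes H1: "\<And>n. H1 (v n)" and lim: "\<And>s. s \<in> {0..1} \<Longrightarrow> (\<lambda>n. v n s) \<longlonglongrightarrow> u s"
    and cont: "continuous_on {0..1} u" and fin: "liminf (\<lambda>n. kinetic (v n)) < \<infinity>"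
  shows "H1 u" "kinetic u \<le> liminf (\<lambda>n. kinetic (v n))"
proof -
  obtain K where K: "liminf (\<lambda>n. kinetic (v n)) = ennreal K" "K \<ge> 0"
    using fin by (cases "liminf (\<lambda>n. kinetic (v n))") auto
  have "dyadic_energy u m \<le> K" for m
  proof -
    have "(\<lambda>n. dyadic_energy (v n) m) \<longlonglongrightarrow> dyadic_energy u m"
      unfolding dyadic_energy_def dyadic_inc_def
      by (intro tendsto_sum tendsto_intros lim dyadic_node_mem) auto
    then have "(\<lambda>n. ennreal (dyadic_energy (v n) m)) \<longlonglongrightarrow> ennreal (dyadic_energy u m)"
      by (rule tendsto_ennrealI)
    then have "ennreal (dyadic_energy u m) = liminf (\<lambda>n. ennreal (dyadic_energy (v n) m))"
      by (intro lim_imp_Liminf[symmetric]) auto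
    also have "\<dots> \<le> ennreal K"
      unfolding K(1)[symmetric] by (intro Liminf_mono always_eventually allI dyadic_energy_le_kinetic H1)
    finally show ?thesis using K(2) by (simp add: ennreal_le_iff)
  qed
  from H1_of_dyadic_energy_bound[OF cont this] show "H1 u" "kinetic u \<le> liminf (\<lambda>n. kinetic (v n))"
    by (simp_all add: K(1))
qed

section \<open>The potential factor\<close>

text \<open>The conformal factor of the Jacobi metric, with value infinity at the collision.\<close>

definition jacobi_weight :: "real \<Rightarrow> real \<Rightarrow> complex \<Rightarrow> ennreal" where
  "jacobi_weight \<beta> h z = (if z = 0 then \<infinity> else ennreal (h - V \<beta> z))"

text \<open>As the inverse of 0 in \<open>ennreal\<close> is infinity, one formula covers the origin
  too. Continuity of the weight there, and with it Fatou along curves whose limit collides, needs no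
  truncation.\<close>

lemma jacobi_weight_eq:
  assumes "\<beta> > 0" "h > 0"
  shows "jacobi_weight \<beta> h z = ennreal h + inverse (ennreal (cmod z)) + ennreal \<beta> * inverse (ennreal ((cmod z)\<^sup>2))"
proof (cases "z = 0")
  case True
  then show ?thesis using assms by (simp add: jacobi_weight_def ennreal_mult_top)
next
  case False
  then have "ennreal h + inverse (ennreal (cmod z)) + ennreal \<beta> * inverse (ennreal ((cmod z)\<^sup>2))
      = ennreal (h + inverse (cmod z) + \<beta> * inverse ((cmod z)\<^sup>2))"
    using assms by (simp add: inverse_ennreal ennreal_mult ennreal_plus)
  with False show ?thesis by (simp add: jacobi_weight_def V_def field_simps)
qed

lemma tendsto_jacobi_weight:
  assumes "\<beta> > 0" "h > 0" "(f \<longlongrightarrow> z) F"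
  shows "((\<lambda>x. jacobi_weight \<beta> h (f x)) \<longlongrightarrow> jacobi_weight \<beta> h z) F"
  unfolding jacobi_weight_eq[OF assms(1,2)]
proof -
  have inv: "((\<lambda>x. inverse (g x)) \<longlongrightarrow> inverse l) F" if "(g \<longlongrightarrow> l) F" for g :: "'a \<Rightarrow> ennreal" and l
    by (rule continuous_on_tendsto_compose[OF continuous_on_inverse_ennreal[OF continuous_on_id] that, of UNIV]) auto
  show "((\<lambda>x. ennreal h + inverse (ennreal (cmod (f x))) + ennreal \<beta> * inverse (ennreal ((cmod (f x))\<^sup>2)))
    \<longlongrightarrow> ennreal h + inverse (ennreal (cmod z)) + ennreal \<beta> * inverse (ennreal ((cmod z)\<^sup>2))) F"
    by (intro tendsto_add ennreal_tendsto_cmult inv tendsto_ennrealI tendsto_intros assms) auto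
qed

lemma potential_eq: "potential \<beta> h u = (\<integral>\<^sup>+ s\<in>{0..1}. jacobi_weight \<beta> h (u s) \<partial>lborel)"
  by (simp add: potential_def jacobi_weight_def)

lemma borel_measurable_jacobi_weight:
  fixes u :: "real \<Rightarrow> complex"
  assumes "\<beta> > 0" "h > 0" "continuous_on {0..1} u"
  shows "(\<lambda>s. jacobi_weight \<beta> h (u s) * indicator {0..1} s) \<in> borel_measurable borel"
proof -
  have "continuous_on {0..1} (\<lambda>s. jacobi_weight \<beta> h (u s))"
    unfolding continuous_on_def
    using assms by (auto intro!: tendsto_jacobi_weight simp: continuous_on_def)
  \<comment> \<open>Clamping the time to the unit interval extends the weight continuously to the
    line, where continuity gives Borel measurability.\<close>
  then have "continuous_on UNIV (\<lambda>s::real. jacobi_weight \<beta> h (u (max 0 (min 1 s))))"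
    by (rule continuous_on_compose2[where g = "\<lambda>s. jacobi_weight \<beta> h (u s)"]) (auto intro!: continuous_on_max continuous_on_min continuous_on_const continuous_on_id)
  then have [measurable]: "(\<lambda>s. jacobi_weight \<beta> h (u (max 0 (min 1 s)))) \<in> borel_measurable borel"
    by (rule borel_measurable_continuous_onI)
  have "(\<lambda>s. jacobi_weight \<beta> h (u s) * indicator {0..1} s)
    = (\<lambda>s. jacobi_weight \<beta> h (u (max 0 (min 1 s))) * indicator {0..1} s)"
    by (auto split: split_indicator)
  then show ?thesis by simp
qed

lemma potential_lower_semicontinuous:
  assumes "\<beta> > 0" "h > 0" and cont: "\<And>n. continuous_on {0..1} (v n)"
    and lim: "\<And>s. s \<in> {0..1} \<Longrightarrow> (\<lambda>n. v n s) \<longlonglongrightarrow> u s"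
  shows "potential \<beta> h u \<le> liminf (\<lambda>n. potential \<beta> h (v n))"
proof -
  let ?f = "\<lambda>u s. jacobi_weight \<beta> h (u s) * indicator {0..1::real} s"
  have "potential \<beta> h u \<le> (\<integral>\<^sup>+ s. liminf (\<lambda>n. ?f (v n) s) \<partial>lborel)"
    unfolding potential_eq
  proof (rule nn_integral_mono)
    fix s :: real
    show "?f u s \<le> liminf (\<lambda>n. ?f (v n) s)"
    proof (cases "s \<in> {0..1}")
      case True
      then have "(\<lambda>n. ?f (v n) s) \<longlonglongrightarrow> ?f u s"
        using tendsto_jacobi_weight[OF assms(1,2) lim[OF True]] by simp
      then show ?thesis by (simp add: lim_imp_Liminf)
    qed simp
  qed
  also have "\<dots> \<le> liminf (\<lambda>n. potential \<beta> h (v n))"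
    unfolding potential_eq
    by (rule nn_integral_liminf) (simp add: borel_measurable_jacobi_weight assms)
  finally show ?thesis .
qed

lemma potential_ge:
  assumes "\<beta> > 0" "h > 0"
  shows "ennreal h \<le> potential \<beta> h u"
proof -
  have "ennreal h = (\<integral>\<^sup>+ s\<in>{0..1}. ennreal h \<partial>(lborel :: real measure))"
    by (simp add: nn_integral_cmult_indicator)
  also have "\<dots> \<le> potential \<beta> h u"
    unfolding potential_eq
    by (intro nn_integral_mono mult_right_mono)
      (auto simp: jacobi_weight_eq[OF assms] add.assoc intro: add_increasing2)
  finally show ?thesis .
qed

section \<open>The direct method\<close>

text \<open>Multiplication in \<open>ennreal\<close> commutes with suprema, so only products of tail
  infima need a bound; those from \<open>i\<close> and \<open>j\<close> are both available from
  \<open>max i j\<close> on.\<close>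

lemma liminf_mult_le_ennreal:
  fixes a b :: "nat \<Rightarrow> ennreal"
  shows "liminf a * liminf b \<le> liminf (\<lambda>n. a n * b n)"
proof -
  let ?A = "\<lambda>n. INF m\<in>{n..}. a m" and ?B = "\<lambda>n. INF m\<in>{n..}. b m"
  have "?A i * ?B j \<le> liminf (\<lambda>n. a n * b n)" for i j
  proof -
    have "?A i * ?B j \<le> (INF m\<in>{max i j..}. a m * b m)"
      by (intro INF_greatest mult_mono INF_lower) auto
    also have "\<dots> \<le> liminf (\<lambda>n. a n * b n)"
      unfolding liminf_SUP_INF by (rule SUP_upper) simp
    finally show ?thesis .
  qed
  then show ?thesis
    unfolding liminf_SUP_INF[of a] liminf_SUP_INF[of b] SUP_mult_left_ennreal SUP_mult_right_ennreal
    by (intro SUP_least)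
qed

text \<open>Both loops are closed by the same segment, which misses the origin. On the curves the
  distance is below the distance to the origin, and on the segment it is zero, so the winding
  numbers agree.\<close>

lemma ind_on_nearby:
  assumes "continuous_on {0..1} u" "continuous_on {0..1} v" "u 0 = v 0" "u 1 = v 1"
    and seg: "0 \<notin> closed_segment (u 1) (u 0)"
    and near: "\<And>s. s \<in> {0..1} \<Longrightarrow> cmod (v s - u s) < cmod (u s)"
  shows "ind_on v 0 1 = ind_on u 0 1"
proof -
  have eq: "w \<circ> (\<lambda>s. 0 + s * (1 - 0)) = w" for w :: "real \<Rightarrow> complex" by (simp add: comp_def)
  have seg': "linepath (u 1) (u 0) s \<noteq> 0" if "s \<in> {0..1}" for s
    using seg that by (metis linepath_in_path)
  have loop: "path (w +++ linepath (w 1) (w 0))"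
    "pathfinish (w +++ linepath (w 1) (w 0)) = pathstart (w +++ linepath (w 1) (w 0))"
    if "continuous_on {0..1} w" for w :: "real \<Rightarrow> complex"
  proof -
    have "path w" "pathfinish w = w 1" "pathstart w = w 0"
      using that by (simp_all add: path_def pathfinish_def pathstart_def)
    then show "path (w +++ linepath (w 1) (w 0))"
      "pathfinish (w +++ linepath (w 1) (w 0)) = pathstart (w +++ linepath (w 1) (w 0))" by simp_all
  qed
  show ?thesis
    unfolding ind_on_def eq
  proof (rule winding_number_nearby_loops_eq)
    fix t :: real assume t: "t \<in> {0..1}"
    show "cmod ((v +++ linepath (v 1) (v 0)) t - (u +++ linepath (u 1) (u 0)) t)
        < cmod ((u +++ linepath (u 1) (u 0)) t - 0)"
      using t near[of "2 * t"] seg'[of "2 * t - 1"] assms(3,4) by (auto simp: joinpaths_def)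
  qed (fact loop[OF assms(1)] loop[OF assms(2)])+
qed

text \<open>The geometry of \<open>D\<close> enters only through compactness, nonemptiness of the
  class, and a closing segment off the origin.\<close>

lemma Maupertuis_minimizer_exists:
  assumes "\<beta> > 0" "h > 0" "compact D" "0 \<notin> closed_segment z1 z0" and ne: "Hk D z0 z1 k \<noteq> {}"
  shows "\<exists>u\<in>Hk D z0 z1 k. \<forall>v\<in>Hk D z0 z1 k. Maupertuis \<beta> h u \<le> Maupertuis \<beta> h v"
proof -
  let ?H = "Hk D z0 z1 k" and ?M = "Maupertuis \<beta> h"
  define I where "I = Inf (?M ` ?H)"
  have suff: ?thesis if "u \<in> ?H" "?M u \<le> I" for u
    using that unfolding I_def by (meson INF_lower order_trans)
  show ?thesis
  proof (cases "I = \<infinity>")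
    \<comment> \<open>With an infinite infimum every member of the class is a minimizer.\<close>
    case True
    then show ?thesis using ne suff by auto
  next
    case False
    obtain f where f: "decseq f" "range f \<subseteq> ?M ` ?H" "I = (INF i. f i)"
      using ennreal_Inf_countable_INF[of "?M ` ?H"] ne unfolding I_def by auto
    have "\<forall>n. \<exists>v\<in>?H. f n = ?M v" using f(2) by blast
    then obtain v where v: "\<And>n. v n \<in> ?H" "\<And>n. f n = ?M (v n)" by metis
    have fI: "f \<longlonglongrightarrow> I" using f(1,3) by (simp add: LIMSEQ_INF)
    have "I < I + 1" using False by (cases I) (auto simp: ennreal_less_iff simp flip: ennreal_1 ennreal_plus)
    then have "\<forall>\<^sub>F n in sequentially. f n < I + 1" by (rule order_tendstoD(2)[OF fI])
    then obtain N where "f N < I + 1" by (auto simp: eventually_sequentially)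
    then have "f N < \<infinity>" by (simp add: less_top order_less_le_trans)
    \<comment> \<open>Dropping the first \<open>N\<close> terms of the decreasing sequence leaves
      curves whose functional is at most the finite number \<open>f N\<close>.\<close>
    define V where "V n = v (n + N)" for n
    have V: "V n \<in> ?H" for n by (simp add: V_def v)
    have V_D: "H1 (V n)" "V n ` {0..1} \<subseteq> D" "V n 0 = z0" "V n 1 = z1" for n
      using V[of n] by (auto simp: Hk_def Hhat_def Coll_def)
    have MV: "(\<lambda>n. ?M (V n)) \<longlonglongrightarrow> I"
      using LIMSEQ_ignore_initial_segment[OF fI, of N] by (simp add: V_def v)
    define B where "B = 2 * f N / ennreal h"
    have KB: "kinetic (V n) \<le> B" for n
    proof -
      have "kinetic (V n) * ennreal h \<le> kinetic (V n) * potential \<beta> h (V n)"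
        by (intro mult_left_mono potential_ge assms) auto
      also have "\<dots> = 2 * ?M (V n)"
      proof -
        have "2 * ennreal (1/2) = ennreal (2 * (1/2))" by (subst ennreal_mult) auto
        then have "2 * ennreal (1/2) = 1" by simp
        then show ?thesis by (simp add: Maupertuis_def mult.assoc[symmetric])
      qed
      also have "?M (V n) \<le> f N" using f(1) by (simp add: V_def flip: v(2)) (simp add: decseqD)
      finally have "kinetic (V n) * ennreal h \<le> 2 * f N" by (simp add: mult_left_mono)
      then have "kinetic (V n) * ennreal h / ennreal h \<le> B"
        unfolding B_def by (rule divide_right_mono_ennreal)
      also have "kinetic (V n) * ennreal h / ennreal h = kinetic (V n)"
        using assms by (simp add: ennreal_mult_divide_eq)
      finally show ?thesis .
    qed
    have "B < \<infinity>"
      using \<open>f N < \<infinity>\<close> assms by (simp add: B_def ennreal_divide_eq_top_iff less_top[symmetric] ennreal_mult_eq_top_iff)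
    then obtain C where C: "B = ennreal C" "C \<ge> 0" by (cases B) auto
    have holder: "cmod (V n s - V n t) \<le> sqrt (\<bar>s - t\<bar> * C)" if "s \<in> {0..1}" "t \<in> {0..1}" for n s t
    proof (rule real_le_rsqrt)
      have "ennreal ((cmod (V n s - V n t))\<^sup>2) \<le> ennreal \<bar>s - t\<bar> * kinetic (V n)"
        using H1_holder[OF V_D(1) that(2,1)] .
      also have "\<dots> \<le> ennreal \<bar>s - t\<bar> * ennreal C"
        using KB[of n] C by (intro mult_left_mono) auto
      also have "\<dots> = ennreal (\<bar>s - t\<bar> * C)" using C by (simp add: ennreal_mult)
      finally show "(cmod (V n s - V n t))\<^sup>2 \<le> \<bar>s - t\<bar> * C" using C by (simp add: ennreal_le_iff)
    qed
    obtain R where R: "\<And>z. z \<in> D \<Longrightarrow> norm z \<le> R"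
      using compact_imp_bounded[OF \<open>compact D\<close>] by (auto simp: bounded_iff)
    obtain g k' where g: "continuous_on {0..1} g" "strict_mono (k' :: nat \<Rightarrow> nat)"
      and unif: "\<And>e. 0 < e \<Longrightarrow> \<exists>N. \<forall>n x. n \<ge> N \<and> x \<in> {0..1} \<longrightarrow> norm (V (k' n) x - g x) < e"
    proof (rule Arzela_Ascoli[of "{0..1::real}" V R])
      show "norm (V n x) \<le> R" if "x \<in> {0..1}" for n x using R V_D(2)[of n] that by blast
      show "\<exists>d>0. \<forall>n y. y \<in> {0..1} \<and> norm (x - y) < d \<longrightarrow> norm (V n x - V n y) < e"
        if x: "x \<in> {0..1}" and e: "0 < e" for x e :: real
      \<comment> \<open>The Hoelder bound asks for \<open>e\<^sup>2 / C\<close>; adding 1 covers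
        \<open>C = 0\<close>.\<close>
      proof (intro exI[of _ "e\<^sup>2 / (C + 1)"] conjI allI impI)
        show "0 < e\<^sup>2 / (C + 1)" using e C by simp
        fix n y assume y: "y \<in> {0..1} \<and> norm (x - y) < e\<^sup>2 / (C + 1)"
        then have "\<bar>x - y\<bar> * (C + 1) < e\<^sup>2" using C by (simp add: field_simps)
        then have "\<bar>x - y\<bar> * C < e\<^sup>2" by (simp add: distrib_left)
        then have "sqrt (\<bar>x - y\<bar> * C) < e" using e by (simp add: real_less_lsqrt C)
        then show "norm (V n x - V n y) < e" using holder[OF x, of y n] y by simp
      qed
    qed auto
    define W where "W n = V (k' n)" for n
    have lim: "(\<lambda>n. W n s) \<longlonglongrightarrow> g s" if "s \<in> {0..1}" for s
      unfolding W_def using unif that by (intro LIMSEQ_I) blast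
    have "liminf (\<lambda>n. kinetic (W n)) \<le> B"
      by (rule Liminf_le) (auto simp: W_def KB)
    then have "liminf (\<lambda>n. kinetic (W n)) < \<infinity>" using \<open>B < \<infinity>\<close> by (rule order_le_less_trans)
    note lsc = kinetic_lower_semicontinuous[of W g, OF _ lim g(1) this]
    have H1g: "H1 g" and Kg: "kinetic g \<le> liminf (\<lambda>n. kinetic (W n))"
      by (rule lsc; simp add: W_def V_D)+
    have Pg: "potential \<beta> h g \<le> liminf (\<lambda>n. potential \<beta> h (W n))"
      by (rule potential_lower_semicontinuous[OF assms(1,2) _ lim]) (simp_all add: W_def V_D H1_continuous)
    have "?M g \<le> ennreal (1/2) * (liminf (\<lambda>n. kinetic (W n)) * liminf (\<lambda>n. potential \<beta> h (W n)))"
      unfolding Maupertuis_def mult.assoc using Kg Pg by (intro mult_left_mono mult_mono) auto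
    also have "\<dots> \<le> ennreal (1/2) * liminf (\<lambda>n. kinetic (W n) * potential \<beta> h (W n))"
      by (intro mult_left_mono liminf_mult_le_ennreal) auto
    \<comment> \<open>Seen as the lower limit of a constant sequence, the factor 1/2 is absorbed by
      the same product inequality.\<close>
    also have "\<dots> = liminf (\<lambda>n. ennreal (1/2)) * liminf (\<lambda>n. kinetic (W n) * potential \<beta> h (W n))"
      by (simp add: Liminf_const)
    also have "\<dots> \<le> liminf (\<lambda>n. ?M (W n))"
      unfolding Maupertuis_def mult.assoc by (rule liminf_mult_le_ennreal)
    also have "\<dots> = I"
      using LIMSEQ_subseq_LIMSEQ[OF MV g(2)] by (intro lim_imp_Liminf) (auto simp: W_def comp_def)
    finally have Mg: "?M g \<le> I" .
    have gD: "g ` {0..1} \<subseteq> D"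
    proof clarify
      fix s :: real assume s: "s \<in> {0..1}"
      have "W n s \<in> D" for n using V_D(2)[of "k' n"] s by (auto simp: W_def)
      then show "g s \<in> D"
        using closed_sequentially[OF compact_imp_closed[OF \<open>compact D\<close>] _ lim[OF s]] by blast
    qed
    have g0: "g 0 = z0" and g1: "g 1 = z1"
      using LIMSEQ_unique[OF lim[of 0], of z0] LIMSEQ_unique[OF lim[of 1], of z1] by (simp_all add: W_def V_D)
    have "g \<in> ?H"
    proof (cases "\<exists>s\<in>{0..1}. g s = 0")
      case True
      then show ?thesis using H1g gD g0 g1 by (simp add: Hk_def Coll_def)
    next
      case False
      have "continuous_on {0..1} (\<lambda>s. cmod (g s))" by (intro continuous_intros g)
      \<comment> \<open>A curve avoiding the origin keeps a positive distance from it by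
        compactness. Some \<open>W n\<close> is closer to \<open>g\<close> than this distance, so it
        avoids the origin too and, not being a collision, has index \<open>k\<close>.\<close>
      then obtain m where m: "m \<in> {0..1}" "\<And>s. s \<in> {0..1} \<Longrightarrow> cmod (g m) \<le> cmod (g s)"
        using continuous_attains_inf[of "{0..1::real}" "\<lambda>s. cmod (g s)"] by auto
      have "0 < cmod (g m)" using False m(1) by simp
      from unif[OF this] obtain n where n: "\<And>s. s \<in> {0..1} \<Longrightarrow> cmod (W n s - g s) < cmod (g m)"
        unfolding W_def by blast
      have near: "cmod (W n s - g s) < cmod (g s)" if "s \<in> {0..1}" for s
        using n[OF that] m(2)[OF that] by simp
      then have "W n s \<noteq> 0" if "s \<in> {0..1}" for s using that by fastforce
      then have "W n \<notin> Coll D z0 z1" by (auto simp: Coll_def)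
      moreover have "W n \<in> ?H" by (simp add: W_def V)
      ultimately have "ind_on (W n) 0 1 = of_int k" by (simp add: Hk_def Hhat_def)
      moreover have "ind_on (W n) 0 1 = ind_on g 0 1"
        using near assms(4) g0 g1 V_D[of "k' n"]
        by (intro ind_on_nearby g(1) H1_continuous) (auto simp: W_def)
      ultimately show ?thesis using H1g gD g0 g1 False by (simp add: Hk_def Hhat_def)
    qed
    then show ?thesis using Mg by (rule suff)
  qed
qed

section \<open>Collision curves in the region\<close>

text \<open>Lipschitz curves survive reversal and concatenation, and they are Sobolev curves by
  \<open>H1_lipschitz\<close>.\<close>

definition lipschitz_joined :: "complex set \<Rightarrow> complex \<Rightarrow> complex \<Rightarrow> bool" where
  "lipschitz_joined D a b \<longleftrightarrow>
     (\<exists>C g. C-lipschitz_on {0..1::real} g \<and> g ` {0..1} \<subseteq> D \<and> g 0 = a \<and> g 1 = b)"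

lemma lipschitz_on_affine_compose:
  fixes g :: "real \<Rightarrow> complex"
  assumes "C-lipschitz_on S g" "\<And>s. s \<in> T \<Longrightarrow> c * s + b \<in> S"
  shows "(C * \<bar>c\<bar>)-lipschitz_on T (\<lambda>s. g (c * s + b))"
proof (rule lipschitz_onI)
  fix s t assume "s \<in> T" "t \<in> T"
  then have "dist (g (c * s + b)) (g (c * t + b)) \<le> C * dist (c * s + b) (c * t + b)"
    by (intro lipschitz_onD[OF assms(1)] assms(2))
  also have "dist (c * s + b) (c * t + b) = \<bar>c\<bar> * dist s t"
    by (simp add: dist_real_def abs_mult flip: right_diff_distrib)
  finally show "dist (g (c * s + b)) (g (c * t + b)) \<le> C * \<bar>c\<bar> * dist s t" by (simp add: mult.assoc)
qed (use lipschitz_on_nonneg[OF assms(1)] in simp)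

lemma lipschitz_joined_segment:
  assumes "closed_segment a b \<subseteq> D"
  shows "lipschitz_joined D a b"
  unfolding lipschitz_joined_def
proof (intro exI conjI)
  show "(cmod (b - a))-lipschitz_on {0..1} (linepath a b)"
  proof (rule lipschitz_onI)
    fix s t :: real
    have "linepath a b s - linepath a b t = (s - t) *\<^sub>R (b - a)"
      by (simp add: linepath_def algebra_simps)
    then show "dist (linepath a b s) (linepath a b t) \<le> cmod (b - a) * dist s t"
      by (simp add: dist_norm)
  qed simp
  show "linepath a b ` {0..1} \<subseteq> D" using assms by (simp add: linepath_image_01)
qed (simp_all add: linepath_0' linepath_1')

lemma lipschitz_joined_sym: "lipschitz_joined D a b \<Longrightarrow> lipschitz_joined D b a"
  unfolding lipschitz_joined_def
proof (elim exE conjE)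
  fix C g assume g: "C-lipschitz_on {0..1::real} g" "g ` {0..1} \<subseteq> D" "g 0 = a" "g 1 = b"
  show "\<exists>C g. C-lipschitz_on {0..1::real} g \<and> g ` {0..1} \<subseteq> D \<and> g 0 = b \<and> g 1 = a"
    using g lipschitz_on_affine_compose[OF g(1), of "{0..1}" "-1" 1]
    by (intro exI[of _ C] exI[of _ "\<lambda>s. g (-1 * s + 1)"]) auto
qed

text \<open>Beyond transitivity, the intermediate point is recorded at time 1/2: with
  \<open>c = 0\<close> this is the collision.\<close>

lemma lipschitz_joined_via:
  assumes "lipschitz_joined D a c" "lipschitz_joined D c b"
  shows "\<exists>C g. C-lipschitz_on {0..1::real} g \<and> g ` {0..1} \<subseteq> D \<and> g 0 = a \<and> g 1 = b \<and> g (1/2) = c"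
proof -
  obtain C1 g1 where g1: "C1-lipschitz_on {0..1::real} g1" "g1 ` {0..1} \<subseteq> D" "g1 0 = a" "g1 1 = c"
    using assms(1) by (auto simp: lipschitz_joined_def)
  obtain C2 g2 where g2: "C2-lipschitz_on {0..1::real} g2" "g2 ` {0..1} \<subseteq> D" "g2 0 = c" "g2 1 = b"
    using assms(2) by (auto simp: lipschitz_joined_def)
  let ?g = "\<lambda>s. if s \<le> 1/2 then g1 (2 * s + 0) else g2 (2 * s + -1)"
  have "lipschitz_on (max (C1 * \<bar>2\<bar>) (C2 * \<bar>2\<bar>)) {0..1} ?g"
    by (intro lipschitz_on_concat_max[where b = "1/2"] lipschitz_on_affine_compose[OF g1(1)]
      lipschitz_on_affine_compose[OF g2(1)]) (auto simp: g1 g2)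
  moreover have "?g ` {0..1} \<subseteq> D"
  proof (rule image_subsetI)
    fix s :: real assume s: "s \<in> {0..1}"
    show "?g s \<in> D"
    proof (cases "s \<le> 1/2")
      case True
      then have "2 * s + 0 \<in> {0..1}" using s by simp
      then have "g1 (2 * s + 0) \<in> D" using g1(2) by blast
      then show ?thesis using True by simp
    next
      case False
      then have "2 * s + -1 \<in> {0..1}" using s by simp
      then have "g2 (2 * s + -1) \<in> D" using g2(2) by blast
      then show ?thesis using False by simp
    qed
  qed
  ultimately show ?thesis
  proof (intro exI conjI)
    show "?g 0 = a" "?g 1 = b" "?g (1/2) = c" by (simp_all add: g1 g2)
  qed
qed

lemma lipschitz_joined_trans:
  "lipschitz_joined D a c \<Longrightarrow> lipschitz_joined D c b \<Longrightarrow> lipschitz_joined D a b"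
  using lipschitz_joined_via[of D a c b] unfolding lipschitz_joined_def by blast

lemma Coll_nonempty:
  assumes "lipschitz_joined D z0 0" "lipschitz_joined D 0 z1"
  shows "Coll D z0 z1 \<noteq> {}"
proof -
  obtain C g where g: "C-lipschitz_on {0..1::real} g" "g ` {0..1} \<subseteq> D" "g 0 = z0" "g 1 = z1" "g (1/2) = 0"
    using lipschitz_joined_via[OF assms] by auto
  then have "g \<in> Coll D z0 z1"
    by (auto simp: Coll_def intro!: H1_lipschitz[OF g(1)] bexI[of _ "1/2"])
  then show ?thesis by blast
qed

section \<open>Geometry of the region\<close>

lemma lipschitz_on_of_continuous_vector_derivative:
  fixes f :: "real \<Rightarrow> 'a::real_normed_vector"
  assumes "\<And>t. t \<in> {a..b} \<Longrightarrow> (f has_vector_derivative f' t) (at t)" "continuous_on {a..b} f'"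
  obtains C where "C-lipschitz_on {a..b} f"
proof -
  have "bounded (f' ` {a..b})" using assms(2) by (intro compact_imp_bounded compact_continuous_image) auto
  then obtain B where B: "0 < B" "\<And>t. t \<in> {a..b} \<Longrightarrow> norm (f' t) \<le> B"
    by (auto simp: bounded_pos)
  have "B-lipschitz_on {a..b} f"
  proof (rule bounded_derivative_imp_lipschitz)
    fix t assume t: "t \<in> {a..b}"
    show "(f has_derivative (\<lambda>x. x *\<^sub>R f' t)) (at t within {a..b})"
      using assms(1)[OF t] unfolding has_vector_derivative_def by (rule has_derivative_at_withinI)
    show "onorm (\<lambda>x. x *\<^sub>R f' t) \<le> B"
      by (rule onorm_le) (simp add: mult.commute[of B] mult_left_mono B(2)[OF t])
  qed (use B in auto)
  then show ?thesis by (rule that)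
qed

text \<open>A nonzero index puts the origin inside the loop. A ray from the origin first meets the
  loop at some \<open>p\<close>, and from \<open>p\<close> the loop itself leads to
  \<open>Z t0\<close> and along the segment to \<open>z\<close>. Simplicity of the loop is not
  assumed.\<close>

lemma region_D_facts:
  fixes Z :: "real \<Rightarrow> complex"
  assumes lip: "C-lipschitz_on {t0..t1} Z" and "t0 < t1"
    and nz: "\<And>t. t \<in> {t0..t1} \<Longrightarrow> Z t \<noteq> 0" and seg: "0 \<notin> closed_segment (Z t0) (Z t1)"
    and ind: "ind_on Z t0 t1 \<noteq> 0"
  shows compact_region_D: "compact (region_D Z t0 t1)"
    and lipschitz_joined_region_D: "z \<in> closed_segment (Z t0) (Z t1) \<Longrightarrow> lipschitz_joined (region_D Z t0 t1) z 0"
proof -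
  define \<gamma> where "\<gamma> = (Z \<circ> (\<lambda>s. t0 + s * (t1 - t0))) +++ linepath (Z t1) (Z t0)"
  define S where "S = path_image \<gamma>"
  define D where "D = region_D Z t0 t1"
  have D: "D = S \<union> inside S" by (simp add: D_def region_D_def \<gamma>_def S_def Let_def)
  have img: "(\<lambda>s. t0 + s * (t1 - t0)) ` {0..1} = {t0..t1}"
    using \<open>t0 < t1\<close> image_affinity_atLeastAtMost[of "t1 - t0" t0 0 1] by (simp add: mult.commute add.commute)
  have "continuous_on {0..1} (Z \<circ> (\<lambda>s. t0 + s * (t1 - t0)))"
    using lipschitz_on_continuous_on[OF lip] unfolding img[symmetric]
    by (intro continuous_on_compose continuous_intros) 
  then have arc: "path (Z \<circ> (\<lambda>s. t0 + s * (t1 - t0)))" by (simp add: path_def)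
  then have "path \<gamma>" unfolding \<gamma>_def by (intro path_join_imp) (auto simp: pathfinish_def)
  have loop: "pathfinish \<gamma> = pathstart \<gamma>" by (simp add: \<gamma>_def) (simp add: pathstart_def)
  have S: "S = Z ` {t0..t1} \<union> closed_segment (Z t0) (Z t1)"
    unfolding S_def \<gamma>_def
    by (subst path_image_join) (simp_all add: pathfinish_def path_image_def linepath_image_01 closed_segment_commute img[symmetric] image_image)
  have "compact S" unfolding S_def using \<open>path \<gamma>\<close> by (rule compact_path_image)
  then have "bounded D" unfolding D by (simp add: bounded_inside compact_imp_bounded)
  moreover have "closed D" unfolding D S_def by (rule closed_path_image_Un_inside[OF \<open>path \<gamma>\<close>])
  ultimately show "compact (region_D Z t0 t1)" by (simp add: compact_eq_bounded_closed D_def)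
  have "0 \<notin> S" using nz seg by (auto simp: S)
  \<comment> \<open>Winding numbers vanish in the outside component.\<close>
  moreover have "0 \<notin> outside S"
    using winding_number_zero_in_outside[OF \<open>path \<gamma>\<close> loop, of 0] ind by (auto simp: S_def ind_on_def \<gamma>_def)
  ultimately have "0 \<in> inside S" using inside_Un_outside[of S] by blast
  moreover have "open (inside S)" using \<open>compact S\<close> by (intro open_inside compact_imp_closed)
  ultimately have int0: "0 \<in> interior (inside S)" by (simp add: interior_open)
  have bnd: "bounded (inside S)" using \<open>compact S\<close> by (simp add: bounded_inside compact_imp_bounded)
  \<comment> \<open>The ray in direction 1 leaves the inside first at distance \<open>d\<close>. The
    exit point is on the frontier, hence on the loop, and all earlier points are inside.\<close>
  obtain d :: real where d: "0 < d" "0 + d *\<^sub>R 1 \<in> frontier (inside S)"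
    "\<And>e. 0 \<le> e \<Longrightarrow> e < d \<Longrightarrow> 0 + e *\<^sub>R 1 \<in> interior (inside S)"
    by (rule ray_to_frontier[OF bnd int0 one_neq_zero]) (rule that; blast)
  define p :: complex where "p = of_real d"
  have "frontier (inside S) \<subseteq> S" using \<open>compact S\<close> by (intro frontier_inside_subset compact_imp_closed)
  then have p: "p \<in> S" using d(2) by (auto simp: p_def scaleR_conv_of_real)
  have "closed_segment 0 p \<subseteq> D"
  proof
    fix x assume "x \<in> closed_segment 0 p"
    then obtain r where r: "0 \<le> r" "r \<le> 1" "x = r *\<^sub>R p" by (auto simp: in_segment)
    show "x \<in> D"
    proof (cases "r = 1")
      case True then show ?thesis using p r by (simp add: D)
    next
      case False
      then have "0 + (r * d) *\<^sub>R 1 \<in> interior (inside S)" using d(1) r by (intro d(3)) auto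
      then show ?thesis using interior_subset[of "inside S"] r by (auto simp: D p_def scaleR_conv_of_real)
    qed
  qed
  then have p0: "lipschitz_joined D p 0" by (intro lipschitz_joined_sym[OF lipschitz_joined_segment])
  \<comment> \<open>\<open>Z t0\<close> serves as hub: every point of the loop lies on the segment
    or on the arc, and both start there.\<close>
  have start_seg: "lipschitz_joined D (Z t0) q" if "q \<in> closed_segment (Z t0) (Z t1)" for q
  proof (rule lipschitz_joined_segment)
    have "closed_segment (Z t0) q \<subseteq> closed_segment (Z t0) (Z t1)"
      using that by (simp add: subset_closed_segment)
    then show "closed_segment (Z t0) q \<subseteq> D" by (auto simp: D S)
  qed
  have start_arc: "lipschitz_joined D (Z t0) (Z t)" if t: "t \<in> {t0..t1}" for t
  proof -
    have mem: "(t - t0) * s + t0 \<in> {t0..t1}" if "s \<in> {0..1}" for s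
    proof -
      have "(t - t0) * s \<le> (t - t0) * 1" using t that by (intro mult_left_mono) auto
      then show ?thesis using t that by auto
    qed
    have "(C * \<bar>t - t0\<bar>)-lipschitz_on {0..1} (\<lambda>s. Z ((t - t0) * s + t0))"
      by (rule lipschitz_on_affine_compose[OF lip mem])
    moreover have "(\<lambda>s. Z ((t - t0) * s + t0)) ` {0..1} \<subseteq> D" using mem by (auto simp: D S)
    ultimately show ?thesis unfolding lipschitz_joined_def
      by (intro exI[of _ "C * \<bar>t - t0\<bar>"] exI[of _ "\<lambda>s. Z ((t - t0) * s + t0)"]) simp
  qed
  have "lipschitz_joined D (Z t0) p" using p start_seg start_arc by (auto simp: S)
  then have "lipschitz_joined D (Z t0) 0" using p0 by (rule lipschitz_joined_trans)
  then show "lipschitz_joined (region_D Z t0 t1) z 0" if "z \<in> closed_segment (Z t0) (Z t1)"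
    unfolding D_def[symmetric]
    by (rule lipschitz_joined_trans[OF lipschitz_joined_sym[OF start_seg[OF that]]])
qed

theorem theorem2p8:
  fixes L h \<beta> t0 t1 x0 x1 :: real
    and Z Z' Z'' :: "real \<Rightarrow> complex"
    and z0 z1 :: complex and k :: int
  assumes "L > 0" "h > 0" "\<beta> > 0" "t0 < t1"
    and "\<forall>t\<in>{t0..t1}. Z t \<noteq> 0"
    and "\<forall>t\<in>{t0..t1}. (Z has_vector_derivative Z' t) (at t)"
    and "\<forall>t\<in>{t0..t1}. (Z' has_vector_derivative Z'' t) (at t)"
    and "\<forall>t\<in>{t0..t1}. (V \<beta> has_derivative (\<lambda>w. inner (- Z'' t) w)) (at (Z t))"
    and "\<forall>t\<in>{t0..t1}. (1/2) * (cmod (Z' t))^2 + V \<beta> (Z t) = h"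
    and "Z t0 = Complex x0 (-L)" "Z t1 = Complex x1 (-L)"
    and "\<forall>t\<in>{t0<..<t1}. Im (Z t) > -L"
    and "ind_on Z t0 t1 = 1"
    and "vec_angle (Z' t0) 1 < pi/2"
    and "vec_angle (-1) (Z' t1) > pi/2"
    and "z0 \<in> closed_segment (Complex x0 (-L)) (Complex x1 (-L))"
    and "z1 \<in> closed_segment (Complex x0 (-L)) (Complex x1 (-L))"
    and "k \<noteq> 0"
  shows "\<exists>u\<in>Hk (region_D Z t0 t1) z0 z1 k.
           \<forall>v\<in>Hk (region_D Z t0 t1) z0 z1 k.
             Maupertuis \<beta> h u \<le> Maupertuis \<beta> h v"
proof -
  note seg = assms(16,17)[folded assms(10,11)]
  \<comment> \<open>The closing segment lies on the line at height \<open>- L\<close>, which misses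
    the origin because \<open>L > 0\<close>.\<close>
  have "Im z = - L" if z: "z \<in> closed_segment (Z t0) (Z t1)" for z
  proof -
    obtain r where "z = (1 - r) *\<^sub>R Z t0 + r *\<^sub>R Z t1" using z by (auto simp: in_segment)
    then have "Im z = (1 - r) * (- L) + r * (- L)" by (simp add: assms(10,11))
    then show ?thesis by (simp add: algebra_simps)
  qed
  then have seg0: "0 \<notin> closed_segment (Z t0) (Z t1)" using \<open>L > 0\<close> by force
  have cont: "continuous_on {t0..t1} Z'"
    by (intro continuous_at_imp_continuous_on ballI has_vector_derivative_continuous[OF bspec[OF assms(7)]])
  from lipschitz_on_of_continuous_vector_derivative[OF bspec[OF assms(6)] cont]
  obtain C where lip: "C-lipschitz_on {t0..t1} Z" .
  note D = region_D_facts[OF lip \<open>t0 < t1\<close> _ seg0]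
  have nz: "\<And>t. t \<in> {t0..t1} \<Longrightarrow> Z t \<noteq> 0" and ind: "ind_on Z t0 t1 \<noteq> 0"
    using assms(5,13) by auto
  \<comment> \<open>A curve from \<open>z0\<close> through the origin to \<open>z1\<close> belongs
    to the class for every \<open>k\<close>, so no curve of prescribed index has to be
    constructed.\<close>
  have "Coll (region_D Z t0 t1) z0 z1 \<noteq> {}"
    by (rule Coll_nonempty[OF D(2)[OF nz ind seg(1)] lipschitz_joined_sym[OF D(2)[OF nz ind seg(2)]]])
  moreover have "0 \<notin> closed_segment z1 z0"
    using seg0 closed_segment_subset[OF seg(2,1) convex_closed_segment] by blast
  ultimately show ?thesis
    using D(1)[OF nz ind] assms(2,3) by (intro Maupertuis_minimizer_exists) (auto simp: Hk_def)
qed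

end
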